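(* The following are equivalent over $\mathsf{RCA}_0$: (1) $\mathsf{RT}^2_2$: for every $c\colon[\mathbb{N}]^2\to\{0,1\}$ there are an infinite $H\subseteq\mathbb{N}$ and $i\in\{0,1\}$ with $c(x,y)=i$ for all $(x,y)\in[H]^2$; (2) the weak Rival--Sands theorem $(\mathsf{wRSg})$: for every infinite graph $G=(V,E)$ there is an infinite $H\subseteq V$ such that for every $x\in H$, either $H\cap N(x)$ is infinite or $|H\cap N(x)|\le 1$; (3) the refined weak Rival--Sands theorem $(\mathsf{wRSgr})$: for every infinite graph $G=(V,E)$ there is an infinite $H\subseteq V$ such that for every $x\in H$, either $H\cap N(x)$ is infinite or $H\cap N(x)=\emptyset$.
   Context: We work in second-order arithmetic; $\mathsf{RCA}_0$ consists of the basic axioms of a discretely ordered commutative semiring, $\Sigma^0_1$ induction and $\Delta^0_1$ comprehension. A graph $G=(V,E)$ is a simple undirected graph given by sets $V\subseteq\mathbb{N}$ and $E\subseteq[V]^2$; it is infinite if $V$ is infinite. For $x\in V$, $N(x)=\{y\in V:(x,y)\in E\}$. *)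

theory Defs
  imports Main
begin

text \<open>
  ``Equivalent over RCA\<open>\<^sub>0\<close>'' is read as: equivalent in every model of RCA\<open>\<^sub>0\<close>. A structure for the
  language of second-order arithmetic consists of a first-order part, here an arbitrary type
  \<open>'a\<close> with \<open>0, 1, +, *, <\<close>, and a nonempty collection \<open>S :: 'a set set\<close> over which the set
  variables range. In particular \<open>'a\<close> may be nonstandard and \<open>S\<close> need not be the full power set.

  The basic axioms are carried by the sort
  \<open>{discrete_linordered_semidom, canonically_ordered_monoid_add}\<close>: a discretely ordered
  commutative semiring whose order is \<open>a \<le> b \<longleftrightarrow> (\<exists>c. b = a + c)\<close>. The subtraction that belongs
  to the class is not part of the language; it excludes no structure, since truncated subtraction
  always satisfies the class axioms, as the final lemma of this theory shows.
\<close>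

datatype tm = Var nat | Zero | One | Add tm tm | Mul tm tm

text \<open>
  Formulas all of whose quantifiers are bounded number quantifiers, with separate variable names
  for numbers and sets. \<open>BAll x t \<phi>\<close> is \<open>\<forall>x < t. \<phi>\<close>, where \<open>t\<close> lies outside the scope of \<open>x\<close>.
\<close>

datatype fm = Eq tm tm | Less tm tm | Mem tm nat | Neg fm | Conj fm fm | BAll nat tm fm

primrec val :: "(nat \<Rightarrow> 'a::comm_semiring_1) \<Rightarrow> tm \<Rightarrow> 'a" where
  "val e (Var x) = e x"
| "val e Zero = 0"
| "val e One = 1"
| "val e (Add t u) = val e t + val e u"
| "val e (Mul t u) = val e t * val e u"

primrec sat :: "(nat \<Rightarrow> 'a::discrete_linordered_semidom) \<Rightarrow> (nat \<Rightarrow> 'a set) \<Rightarrow> fm \<Rightarrow> bool" where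
  "sat e s (Eq t u) \<longleftrightarrow> val e t = val e u"
| "sat e s (Less t u) \<longleftrightarrow> val e t < val e u"
| "sat e s (Mem t X) \<longleftrightarrow> val e t \<in> s X"
| "sat e s (Neg \<phi>) \<longleftrightarrow> \<not> sat e s \<phi>"
| "sat e s (Conj \<phi> \<psi>) \<longleftrightarrow> sat e s \<phi> \<and> sat e s \<psi>"
| "sat e s (BAll x t \<phi>) \<longleftrightarrow> (\<forall>a < val e t. sat (e(x := a)) s \<phi>)"

text \<open>Truth of the \<open>\<Sigma>\<^sup>0\<^sub>1\<close> formula \<open>\<exists>y. \<theta>\<close> and of the \<open>\<Pi>\<^sup>0\<^sub>1\<close> formula \<open>\<forall>y. \<theta>\<close>.\<close>

definition sat_Sigma1 ::
  "(nat \<Rightarrow> 'a::discrete_linordered_semidom) \<Rightarrow> (nat \<Rightarrow> 'a set) \<Rightarrow> nat \<Rightarrow> fm \<Rightarrow> bool" where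
  "sat_Sigma1 e s y \<theta> \<longleftrightarrow> (\<exists>b. sat (e(y := b)) s \<theta>)"

definition sat_Pi1 ::
  "(nat \<Rightarrow> 'a::discrete_linordered_semidom) \<Rightarrow> (nat \<Rightarrow> 'a set) \<Rightarrow> nat \<Rightarrow> fm \<Rightarrow> bool" where
  "sat_Pi1 e s y \<theta> \<longleftrightarrow> (\<forall>b. sat (e(y := b)) s \<theta>)"

text \<open>The assignments \<open>e\<close> and \<open>s\<close> supply arbitrary number and set parameters from the model.\<close>

definition Sigma1_induction :: "'a::discrete_linordered_semidom set set \<Rightarrow> bool" where
  "Sigma1_induction S \<longleftrightarrow>
    (\<forall>\<theta> x y e s. range s \<subseteq> S \<longrightarrow>
      sat_Sigma1 (e(x := 0)) s y \<theta> \<longrightarrow>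
      (\<forall>a. sat_Sigma1 (e(x := a)) s y \<theta> \<longrightarrow> sat_Sigma1 (e(x := a + 1)) s y \<theta>) \<longrightarrow>
      (\<forall>a. sat_Sigma1 (e(x := a)) s y \<theta>))"

definition Delta1_comprehension :: "'a::discrete_linordered_semidom set set \<Rightarrow> bool" where
  "Delta1_comprehension S \<longleftrightarrow>
    (\<forall>\<theta> \<eta> x y z e s. range s \<subseteq> S \<longrightarrow>
      (\<forall>a. sat_Sigma1 (e(x := a)) s y \<theta> \<longleftrightarrow> sat_Pi1 (e(x := a)) s z \<eta>) \<longrightarrow>
      (\<exists>X\<in>S. \<forall>a. a \<in> X \<longleftrightarrow> sat_Sigma1 (e(x := a)) s y \<theta>))"

definition models_RCA0 ::
  "'a::{discrete_linordered_semidom, canonically_ordered_monoid_add} set set \<Rightarrow> bool" where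
  "models_RCA0 S \<longleftrightarrow> S \<noteq> {} \<and> Sigma1_induction S \<and> Delta1_comprehension S"

text \<open>The usual code \<open>(x + y)\<^sup>2 + x\<close> of the ordered pair \<open>(x, y)\<close> in RCA\<open>\<^sub>0\<close>.\<close>

definition pair :: "'a::comm_semiring_1 \<Rightarrow> 'a \<Rightarrow> 'a" where
  "pair x y = (x + y) * (x + y) + x"

text \<open>The two-element set \<open>{x, y}\<close> is coded by its increasing ordered pair.\<close>

definition upair :: "'a::discrete_linordered_semidom \<Rightarrow> 'a \<Rightarrow> 'a" where
  "upair x y = pair (min x y) (max x y)"

definition two_subsets :: "'a::discrete_linordered_semidom set \<Rightarrow> 'a set" where
  "two_subsets A = {upair x y | x y. x \<in> A \<and> y \<in> A \<and> x \<noteq> y}"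

text \<open>\<open>f\<close> is (the graph, as a set of pair codes, of) a function from \<open>A\<close> to \<open>B\<close>.\<close>

definition coded_fun :: "'a::comm_semiring_1 set \<Rightarrow> 'a set \<Rightarrow> 'a set \<Rightarrow> bool" where
  "coded_fun f A B \<longleftrightarrow>
    f \<subseteq> {pair x y | x y. x \<in> A \<and> y \<in> B} \<and> (\<forall>x\<in>A. \<exists>!y. y \<in> B \<and> pair x y \<in> f)"

text \<open>Infinity in the sense of the model; this differs from \<^const>\<open>infinite\<close> when \<open>'a\<close> is nonstandard.\<close>

definition unbounded :: "'a::linorder set \<Rightarrow> bool" where
  "unbounded X \<longleftrightarrow> (\<forall>a. \<exists>x\<in>X. a < x)"

definition graph :: "'a::discrete_linordered_semidom set \<Rightarrow> 'a set \<Rightarrow> bool" where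
  "graph V E \<longleftrightarrow> E \<subseteq> two_subsets V"

definition nbhd ::
  "'a::discrete_linordered_semidom set \<Rightarrow> 'a set \<Rightarrow> 'a \<Rightarrow> 'a set" where
  "nbhd V E x = {y\<in>V. upair x y \<in> E}"

definition RT22 :: "'a::discrete_linordered_semidom set set \<Rightarrow> bool" where
  "RT22 S \<longleftrightarrow>
    (\<forall>c\<in>S. coded_fun c (two_subsets UNIV) {0, 1} \<longrightarrow>
      (\<exists>H\<in>S. unbounded H \<and> (\<exists>i\<in>{0, 1}. \<forall>p\<in>two_subsets H. pair p i \<in> c)))"

definition wRSg :: "'a::discrete_linordered_semidom set set \<Rightarrow> bool" where
  "wRSg S \<longleftrightarrow>
    (\<forall>V\<in>S. \<forall>E\<in>S. graph V E \<and> unbounded V \<longrightarrow>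
      (\<exists>H\<in>S. H \<subseteq> V \<and> unbounded H \<and>
        (\<forall>x\<in>H. unbounded (H \<inter> nbhd V E x) \<or>
          (\<forall>y \<in> H \<inter> nbhd V E x. \<forall>z \<in> H \<inter> nbhd V E x. y = z))))"

definition wRSgr :: "'a::discrete_linordered_semidom set set \<Rightarrow> bool" where
  "wRSgr S \<longleftrightarrow>
    (\<forall>V\<in>S. \<forall>E\<in>S. graph V E \<and> unbounded V \<longrightarrow>
      (\<exists>H\<in>S. H \<subseteq> V \<and> unbounded H \<and>
        (\<forall>x\<in>H. unbounded (H \<inter> nbhd V E x) \<or> H \<inter> nbhd V E x = {})))"

lemma (in comm_semiring_1) truncated_diff_class_axioms:
  fixes le less :: "'a \<Rightarrow> 'a \<Rightarrow> bool"
  defines "monus \<equiv> \<lambda>a b. if le b a then THE c. b + c = a else 0"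
  assumes linorder: "class.linorder le less"
    and add_less: "\<And>a b c. less a b \<Longrightarrow> less (a + c) (b + c)"
    and mult_less: "\<And>a b c. less a b \<Longrightarrow> less 0 c \<Longrightarrow> less (a * c) (b * c)"
    and diff_ex: "\<And>a b. less a b \<Longrightarrow> \<exists>c. a + c = b"
    and discrete: "less 0 1" "\<And>a. less 0 a \<Longrightarrow> le 1 a"
    and nonneg: "\<And>a. le 0 a"
  shows "class.discrete_linordered_semidom (+) monus le less 0 (*) 1"
    and "class.canonically_ordered_monoid_add (+) 0 le less"
proof -
  interpret L: linorder le less by (fact linorder)
  have less_iff: "less (a + c) (b + c) \<longleftrightarrow> less a b" for a b c
    by (metis L.less_asym L.less_irrefl L.neqE add_less)
  have cancel: "a + b = a + c \<longleftrightarrow> b = c" for a b c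
    by (metis L.less_irrefl L.neqE add_less add_commute)
  have le_iff: "le a b \<longleftrightarrow> (\<exists>c. b = a + c)" for a b
    by (metis L.le_less L.not_le less_iff add_0_left add_commute diff_ex nonneg add_0_right)
  have monus_add: "monus (a + b) a = b" for a b
    using le_iff by (auto simp: monus_def cancel)
  have monus_0: "\<not> le b a \<Longrightarrow> monus a b = 0" for a b
    by (simp add: monus_def)
  have pos: "less 0 (a * b)" if "less 0 a" "less 0 b" for a b
    using mult_less[OF that] by simp
  show can: "class.canonically_ordered_monoid_add (+) 0 le less"
    by unfold_locales (fact le_iff)
  have md: "monus (monus a b) c = monus a (b + c)" for a b c
  proof (cases "le b a")
    case True
    then obtain d where d: "a = b + d" using le_iff by auto
    have "le (b + c) (b + d) \<longleftrightarrow> le c d" using le_iff by (simp add: add_assoc cancel)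
    then show ?thesis
      by (metis d le_iff monus_0 monus_add add_assoc)
  next
    case False
    then have "\<not> le (b + c) a" using le_iff add_assoc by metis
    moreover have "monus 0 c = 0"
      by (metis L.order_antisym monus_0 monus_add add_0_right nonneg)
    ultimately show ?thesis using False by (simp add: monus_0)
  qed
  have mdist: "a * monus b c = monus (a * b) (a * c)" for a b c
  proof (cases "le c b")
    case True
    then obtain d where d: "b = c + d" using le_iff by auto
    then show ?thesis by (simp add: monus_add distrib_left)
  next
    case False
    then obtain d where d: "c = b + d" using le_iff L.linear by blast
    show ?thesis
      by (metis False d monus_0 monus_add add_0_right md distrib_left mult_zero_right L.order_antisym L.linear le_iff)
  qed
  show "class.discrete_linordered_semidom (+) monus le less 0 (*) 1"
  proof unfold_locales
    show "monus (a + b) a = b" for a b by (fact monus_add)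
    show "monus (monus a b) c = monus a (b + c)" for a b c by (fact md)
    show "a * monus b c = monus (a * b) (a * c)" for a b c by (fact mdist)
    show "a \<noteq> 0 \<Longrightarrow> b \<noteq> 0 \<Longrightarrow> a * b \<noteq> 0" for a b
      by (metis L.le_less L.less_irrefl nonneg pos)
    show "le a b \<Longrightarrow> le (c + a) (c + b)" for a b c
      using le_iff by (auto simp: add_assoc)
    show "less a b \<Longrightarrow> less 0 c \<Longrightarrow> less (c * a) (c * b)" for a b c
      using mult_less by (simp add: mult_commute)
    show "less 0 1" by (fact discrete)
    show "le b a \<Longrightarrow> monus a b + b = a" for a b
      using le_iff monus_add add_commute by metis
    show "less a b \<longleftrightarrow> le (a + 1) b" for a b
    proof
      assume "less a b"
      then obtain c where c: "a + c = b" using diff_ex by blast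
      with \<open>less a b\<close> have "less 0 c"
        by (metis L.le_less L.less_irrefl add_0_right nonneg)
      then obtain d where "c = 1 + d" using discrete le_iff by blast
      then show "le (a + 1) b" using c le_iff add_assoc by metis
    next
      assume "le (a + 1) b"
      moreover have "less a (a + 1)" using add_less[OF discrete(1), of a] by (simp add: add_commute)
      ultimately show "less a b" by (metis L.less_le_trans)
    qed
  qed
qed

end

theory Submission
  imports Defs
begin

text \<open>
  (1) implies (3) because an infinite homogeneous set for the edge colouring is an infinite clique
  or an infinite independent set, and (3) trivially implies (2).

  For (2) implies (1), call a vertex of a solution \<open>H\<close> branching if it has two neighbours in \<open>H\<close>; by
  the choice of \<open>H\<close> it then has infinitely many. If no vertex branches, the edges of \<open>H\<close> form a
  matching, which leaves an infinite independent set. If some branching \<open>x\<close> has only finitely many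
  branching neighbours, its remaining neighbours are adjacent to nothing but \<open>x\<close>, hence independent.
  Otherwise every branching vertex has infinitely many branching neighbours, and as branching is
  \<open>\<Sigma>\<^sub>1\<close>, they can be found by search. Given a colouring, this trichotomy is used twice. Joining
  \<open>x < y\<close> when the string of colours \<open>(c(i,x))\<^sub>i\<^sub><\<^sub>x\<close> is lexicographically at most the corresponding
  initial part of \<open>(c(i,y))\<^sub>i\<^sub><\<^sub>y\<close>, a transitive relation, yields an infinite set along which
  these strings are monotone. There are only finitely many strings of each length, so the colouring
  is stable on this set, uniformly on initial segments, which makes \<open>B\<Sigma>\<^sub>2\<close> unnecessary. Applied to
  the graph of one colour on this set, the trichotomy yields a homogeneous set.
\<close>

section \<open>Arithmetic in a discretely ordered semiring\<close>

lemma less_add_one_iff: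
  fixes a b :: "'a::discrete_linordered_semidom"
  shows "a < b + 1 \<longleftrightarrow> a \<le> b"
  by (metis add_le_cancel_right discrete_linordered_semidom_class.less_iff_succ_less_eq)

lemma add_one_le_iff:
  fixes a b :: "'a::discrete_linordered_semidom"
  shows "a + 1 \<le> b \<longleftrightarrow> a < b"
  by (simp add: discrete_linordered_semidom_class.less_iff_succ_less_eq)

lemma le_mult_self:
  fixes a b :: "'a::{discrete_linordered_semidom, canonically_ordered_monoid_add}"
  assumes "b \<noteq> 0"
  shows "a \<le> a * b"
proof -
  have "1 \<le> b"
    using assms add_one_le_iff[of 0 b] by (simp add: zero_less_iff_neq_zero)
  then show ?thesis
    using mult_left_mono[of 1 b a] by simp
qed

text \<open>The bounds turn the decoding of a pair into a bounded search, so predicates about the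
  components of a code remain bounded formulas.\<close>

lemma le_pair:
  fixes x y :: "'a::{discrete_linordered_semidom, canonically_ordered_monoid_add}"
  shows "x \<le> pair x y" and "y \<le> pair x y"
proof -
  show "x \<le> pair x y"
    by (simp add: pair_def add_increasing)
  have "x + y \<le> (x + y) * (x + y)"
    by (cases "x + y = 0") (auto simp: le_mult_self simp del: add_eq_0_iff_both_eq_0)
  moreover have "y \<le> x + y"
    by (simp add: add_increasing)
  ultimately show "y \<le> pair x y"
    unfolding pair_def by (meson add_increasing2 order_trans zero_le)
qed

text \<open>Codes with component sum \<open>s\<close> lie in the block from \<open>s * s\<close> to
  below \<open>(s + 1) * (s + 1)\<close>, and a greater sum starts at or beyond the end of that
  block. Injectivity of \<open>pair\<close> follows.\<close>

lemma pair_less_if_sum_less: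
  fixes x y :: "'a::{discrete_linordered_semidom, canonically_ordered_monoid_add}"
  assumes "x + y < x' + y'"
  shows "pair x y < pair x' y'"
proof -
  let ?s = "x + y"
  have "x \<le> ?s"
    by (simp add: add_increasing2)
  then have "x < ?s + ?s + 1"
    by (simp only: less_add_one_iff) (simp add: add_increasing2)
  then have "?s * ?s + x < ?s * ?s + (?s + ?s + 1)"
    by (rule add_strict_left_mono)
  also have "?s * ?s + (?s + ?s + 1) = (?s + 1) * (?s + 1)"
    by (simp add: algebra_simps)
  finally have "pair x y < (?s + 1) * (?s + 1)"
    by (simp only: pair_def)
  also have "\<dots> \<le> (x' + y') * (x' + y')"
    using assms by (intro mult_mono) (auto simp: add_one_le_iff)
  also have "\<dots> \<le> pair x' y'"
    by (simp add: pair_def add_increasing2)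
  finally show ?thesis .
qed

lemma pair_eq_iff:
  fixes x y :: "'a::{discrete_linordered_semidom, canonically_ordered_monoid_add}"
  shows "pair x y = pair x' y' \<longleftrightarrow> x = x' \<and> y = y'"
proof
  assume eq: "pair x y = pair x' y'"
  then have s: "x + y = x' + y'"
    by (metis linorder_neqE pair_less_if_sum_less less_irrefl)
  then have "x = x'"
    using eq by (simp add: pair_def)
  then show "x = x' \<and> y = y'"
    using s by simp
qed simp

lemma upair_commute: "upair x y = upair y x"
  by (simp add: upair_def min.commute max.commute)

lemma upair_less: "x < y \<Longrightarrow> upair x y = pair x y"
  by (simp add: upair_def)

lemma two_subsets_eq: "two_subsets A = {pair x y | x y. x \<in> A \<and> y \<in> A \<and> x < y}"
  unfolding two_subsets_def
  by (auto simp: upair_less)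
    (metis linorder_neqE upair_commute upair_less, metis less_irrefl upair_less)

section \<open>Definable predicates\<close>

primrec rename_tm :: "(nat \<Rightarrow> nat) \<Rightarrow> tm \<Rightarrow> tm" where
  "rename_tm f (Var x) = Var (f x)"
| "rename_tm f Zero = Zero"
| "rename_tm f One = One"
| "rename_tm f (Add t u) = Add (rename_tm f t) (rename_tm f u)"
| "rename_tm f (Mul t u) = Mul (rename_tm f t) (rename_tm f u)"

primrec rename_fm :: "(nat \<Rightarrow> nat) \<Rightarrow> (nat \<Rightarrow> nat) \<Rightarrow> fm \<Rightarrow> fm" where
  "rename_fm f g (Eq t u) = Eq (rename_tm f t) (rename_tm f u)"
| "rename_fm f g (Less t u) = Less (rename_tm f t) (rename_tm f u)"
| "rename_fm f g (Mem t X) = Mem (rename_tm f t) (g X)"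
| "rename_fm f g (Neg \<phi>) = Neg (rename_fm f g \<phi>)"
| "rename_fm f g (Conj \<phi> \<psi>) = Conj (rename_fm f g \<phi>) (rename_fm f g \<psi>)"
| "rename_fm f g (BAll x t \<phi>) = BAll (f x) (rename_tm f t) (rename_fm f g \<phi>)"

lemma val_rename_tm: "val e (rename_tm f t) = val (e \<circ> f) t"
  by (induction t) simp_all

text \<open>Bound number variables are renamed together with the free ones; injectivity of
  \<open>f\<close> prevents capture.\<close>

lemma sat_rename_fm:
  assumes "inj f"
  shows "sat e s (rename_fm f g \<phi>) \<longleftrightarrow> sat (e \<circ> f) (s \<circ> g) \<phi>"
proof (induction \<phi> arbitrary: e)
  case (BAll x t \<phi>)
  have "e(f x := a) \<circ> f = (e \<circ> f)(x := a)" for a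
    using assms by (auto simp: fun_eq_iff inj_eq)
  then show ?case
    by (simp only: BAll.IH val_rename_tm sat.simps rename_fm.simps)
qed (simp_all add: val_rename_tm)

definition interleave :: "(nat \<Rightarrow> 'b) \<Rightarrow> (nat \<Rightarrow> 'b) \<Rightarrow> nat \<Rightarrow> 'b" where
  "interleave e q k = (if even k then e (k div 2) else q (k div 2))"

lemma interleave_simps: "interleave e q (2 * k) = e k" "interleave e q (2 * k + 1) = q k"
  by (simp_all add: interleave_def)

text \<open>The parameter lists of two formulas merge into \<open>interleave q r\<close>. Parameter
  \<open>j\<close> sits at variable \<open>k = 2 * j + 1\<close>; it moves to
  \<open>4 * j + 1 = 2 * k - 1\<close> if it comes from \<open>q\<close> and to
  \<open>4 * j + 3 = 2 * k + 1\<close> if it comes from \<open>r\<close>. Arguments stay in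
  place.\<close>

lemma interleave_left:
  "interleave e (interleave q r) \<circ> (\<lambda>k. if even k then k else 2 * k - 1) = interleave e q"
proof
  fix k
  show "(interleave e (interleave q r) \<circ> (\<lambda>k. if even k then k else 2 * k - 1)) k = interleave e q k"
  proof (cases "even k")
    case False
    then obtain j where "k = 2 * j + 1"
      by (elim oddE)
    then have "2 * k - 1 = 2 * (2 * j) + 1" "k div 2 = j"
      by simp_all
    then show ?thesis
      using False by (simp add: interleave_def del: One_nat_def)
  qed (simp add: interleave_def)
qed

lemma interleave_right:
  "interleave e (interleave q r) \<circ> (\<lambda>k. if even k then k else 2 * k + 1) = interleave e r"
  by (auto simp: interleave_def fun_eq_iff elim!: oddE)

lemma inj_left: "inj (\<lambda>k::nat. if even k then k else 2 * k - 1)"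
  by (rule injI) (auto split: if_splits elim!: oddE)

lemma inj_right: "inj (\<lambda>k::nat. if even k then k else 2 * k + 1)"
  by (rule injI) (auto split: if_splits)

text \<open>
  Even variables carry the arguments, odd ones the number parameters from the model; arguments are
  numbered in de Bruijn style, so that a quantifier shifts them by one.
\<close>

definition definable_term :: "((nat \<Rightarrow> 'a::discrete_linordered_semidom) \<Rightarrow> 'a) \<Rightarrow> bool" where
  "definable_term F \<longleftrightarrow> (\<exists>t q. \<forall>e. F e = val (interleave e q) t)"

lemma definable_term_common:
  assumes "definable_term F" "definable_term G"
  obtains t u q where "\<And>e. F e = val (interleave e q) t" "\<And>e. G e = val (interleave e q) u"
proof -
  obtain t q u r where "\<And>e. F e = val (interleave e q) t" "\<And>e. G e = val (interleave e r) u"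
    using assms unfolding definable_term_def by metis
  then show thesis
    using that[where q = "interleave q r"
        and t = "rename_tm (\<lambda>k. if even k then k else 2 * k - 1) t"
        and u = "rename_tm (\<lambda>k. if even k then k else 2 * k + 1) u"]
    by (simp add: val_rename_tm interleave_left interleave_right)
qed

section \<open>Closure properties of predicates given by bounded formulas\<close>

locale rca0 =
  fixes S :: "'a::{discrete_linordered_semidom, canonically_ordered_monoid_add} set set"
  assumes model: "models_RCA0 S"
begin


text \<open>Truth of a bounded formula with number and set parameters from the model, as a predicate
  of the whole argument list. The closure lemmas allow definability to be checked on HOL predicates
  by introduction rules instead of by writing formulas.\<close>

definition D0 :: "((nat \<Rightarrow> 'a) \<Rightarrow> bool) \<Rightarrow> bool" where
  "D0 P \<longleftrightarrow> (\<exists>\<phi> q s. range s \<subseteq> S \<and> (\<forall>e. P e \<longleftrightarrow> sat (interleave e q) s \<phi>))"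

lemma definable_term_var: "definable_term (\<lambda>e :: nat \<Rightarrow> 'a. e n)"
  unfolding definable_term_def
  by (intro exI[of _ "Var (2 * n)"]) (simp add: interleave_def)

lemma definable_term_const: "definable_term (\<lambda>e. c :: 'a)"
  unfolding definable_term_def
  by (intro exI[of _ "Var 1"] exI[of _ "\<lambda>_. c"]) (simp add: interleave_def)

lemma definable_term_add:
  fixes F G :: "(nat \<Rightarrow> 'a) \<Rightarrow> 'a"
  assumes "definable_term F" "definable_term G"
  shows "definable_term (\<lambda>e. F e + G e)"
  using definable_term_common[OF assms] unfolding definable_term_def by (metis val.simps(4))

lemma definable_term_mult:
  fixes F G :: "(nat \<Rightarrow> 'a) \<Rightarrow> 'a"
  assumes "definable_term F" "definable_term G"
  shows "definable_term (\<lambda>e. F e * G e)"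
  using definable_term_common[OF assms] unfolding definable_term_def by (metis val.simps(5))

lemma S_nonempty: "\<exists>X. X \<in> S"
  using model unfolding models_RCA0_def by auto

lemma D0_eq:
  assumes "definable_term F" "definable_term G"
  shows "D0 (\<lambda>e. F e = G e)"
proof -
  obtain t u q where "\<And>e. F e = val (interleave e q) t" "\<And>e. G e = val (interleave e q) u"
    using definable_term_common[OF assms] by metis
  moreover obtain X where "X \<in> S" using S_nonempty by blast
  ultimately show ?thesis
    unfolding D0_def by (intro exI[of _ "Eq t u"] exI[of _ q] exI[of _ "\<lambda>_. X"]) auto
qed

lemma D0_less:
  assumes "definable_term F" "definable_term G"
  shows "D0 (\<lambda>e. F e < G e)"
proof -
  obtain t u q where "\<And>e. F e = val (interleave e q) t" "\<And>e. G e = val (interleave e q) u"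
    using definable_term_common[OF assms] by metis
  moreover obtain X where "X \<in> S" using S_nonempty by blast
  ultimately show ?thesis
    unfolding D0_def by (intro exI[of _ "Less t u"] exI[of _ q] exI[of _ "\<lambda>_. X"]) auto
qed

lemma D0_mem:
  assumes "X \<in> S" "definable_term F"
  shows "D0 (\<lambda>e. F e \<in> X)"
proof -
  obtain t q where "\<And>e. F e = val (interleave e q) t"
    using assms(2) unfolding definable_term_def by metis
  with \<open>X \<in> S\<close> show ?thesis
    unfolding D0_def by (intro exI[of _ "Mem t 0"] exI[of _ q] exI[of _ "\<lambda>_. X"]) auto
qed

lemma D0_not: "D0 P \<Longrightarrow> D0 (\<lambda>e. \<not> P e)"
  unfolding D0_def by (metis sat.simps(4))

lemma D0_common:
  assumes "D0 P" "D0 Q"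
  obtains \<phi> \<psi> q s where "range s \<subseteq> S" "\<And>e. P e \<longleftrightarrow> sat (interleave e q) s \<phi>"
    "\<And>e. Q e \<longleftrightarrow> sat (interleave e q) s \<psi>"
proof -
  obtain \<phi> q s \<psi> r u where P: "range s \<subseteq> S" "\<And>e. P e \<longleftrightarrow> sat (interleave e q) s \<phi>"
    and Q: "range u \<subseteq> S" "\<And>e. Q e \<longleftrightarrow> sat (interleave e r) u \<psi>"
    using assms unfolding D0_def by metis
  let ?l = "rename_fm (\<lambda>k. if even k then k else 2 * k - 1) ((*) 2) \<phi>"
  let ?r = "rename_fm (\<lambda>k. if even k then k else 2 * k + 1) (\<lambda>k. 2 * k + 1) \<psi>"
  let ?s = "interleave s u"
  have "?s \<circ> (*) 2 = s" "?s \<circ> (\<lambda>k. 2 * k + 1) = u"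
    by (auto simp: interleave_def fun_eq_iff)
  then have "P e \<longleftrightarrow> sat (interleave e (interleave q r)) ?s ?l"
    and "Q e \<longleftrightarrow> sat (interleave e (interleave q r)) ?s ?r" for e
    by (simp_all add: P Q sat_rename_fm inj_left inj_right interleave_left interleave_right)
  moreover have "range ?s \<subseteq> S"
    using P Q by (auto simp: interleave_def)
  ultimately show thesis
    using that by blast
qed

lemma D0_conj:
  assumes "D0 P" "D0 Q"
  shows "D0 (\<lambda>e. P e \<and> Q e)"
  using D0_common[OF assms] unfolding D0_def by (metis sat.simps(5))

lemma D0_all_less:
  assumes "definable_term F" "D0 (\<lambda>e. P (e 0) (\<lambda>n. e (Suc n)))"
  shows "D0 (\<lambda>e. \<forall>a < F e. P a e)"
proof -
  obtain t r where t: "\<And>e. F e = val (interleave e r) t"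
    using assms(1) unfolding definable_term_def by metis
  obtain \<phi> q s where s: "range s \<subseteq> S"
    and P: "\<And>e. P (e 0) (\<lambda>n. e (Suc n)) \<longleftrightarrow> sat (interleave e q) s \<phi>"
    using assms(2) unfolding D0_def by auto
  \<comment> \<open>The quantified argument becomes variable 3, whose slot in the merged list
    \<open>?p\<close> holds only a padding zero and to which no other variable is sent. The other
    arguments move back one place; parameter \<open>j\<close> of \<open>\<phi>\<close> goes to
    variable \<open>8 * j + 1\<close>, that of \<open>t\<close> to \<open>8 * j + 7\<close>.\<close>
  let ?f = "\<lambda>k::nat. if k = 0 then 3 else if even k then k - 2 else 4 * k - 3"
  let ?g = "\<lambda>k::nat. if even k then k else 4 * k + 3"
  let ?p = "interleave (interleave q (\<lambda>_. 0)) (interleave (\<lambda>_. 0) r)"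
  have inj: "inj ?f"
    by (rule inj_on_inverseI[where
          g = "\<lambda>m. if m = 3 then 0 else if even m then m + 2 else (m + 3) div 4"])
      (auto elim!: oddE, presburger)
  have f: "(interleave e ?p)(3 := a) \<circ> ?f = interleave (case_nat a e) q" for a e
  proof
    fix k
    consider "k = 0" | j where "k = 2 * Suc j" | j where "k = 2 * j + 1"
      by (cases "even k"; cases "k div 2") (auto elim!: evenE oddE)
    then show "((interleave e ?p)(3 := a) \<circ> ?f) k = interleave (case_nat a e) q k"
    proof cases
      case 3
      then have "?f k = 2 * (2 * (2 * j)) + 1"
        by simp
      with 3 show ?thesis
        by (simp add: interleave_def del: One_nat_def)
    next
      case 2
      then have "?f k = 2 * j" "2 * j \<noteq> 3"
        by (simp, presburger)
      with 2 show ?thesis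
        by (simp add: interleave_def)
    qed (simp add: interleave_def)
  qed
  have g: "interleave e ?p \<circ> ?g = interleave e r" for e
  proof
    fix k
    show "(interleave e ?p \<circ> ?g) k = interleave e r k"
    proof (cases "even k")
      case False
      then obtain j where k: "k = 2 * j + 1"
        by (elim oddE)
      then have "?g k = 2 * (2 * (2 * j + 1) + 1) + 1"
        by simp
      then show ?thesis
        unfolding comp_apply k by (simp only: interleave_simps)
    qed (simp add: interleave_def)
  qed
  show ?thesis
    unfolding D0_def
  proof (intro exI conjI allI)
    fix e
    have "P a e \<longleftrightarrow> sat ((interleave e ?p)(3 := a)) s (rename_fm ?f id \<phi>)" for a
      using P[of "case_nat a e"] by (simp only: sat_rename_fm[OF inj] f) simp
    then show "(\<forall>a < F e. P a e) \<longleftrightarrow>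
        sat (interleave e ?p) s (BAll 3 (rename_tm ?g t) (rename_fm ?f id \<phi>))"
      by (simp only: sat.simps val_rename_tm g t)
  qed (fact s)
qed

lemma D0_cong: "D0 P \<Longrightarrow> (\<And>e. P e \<longleftrightarrow> Q e) \<Longrightarrow> D0 Q"
  by (simp add: D0_def)

lemma D0_le: "definable_term F \<Longrightarrow> definable_term G \<Longrightarrow> D0 (\<lambda>e. F e \<le> G e)"
  using D0_not[OF D0_less] by (rule D0_cong) (auto simp: not_less)

lemma D0_disj: "D0 P \<Longrightarrow> D0 Q \<Longrightarrow> D0 (\<lambda>e. P e \<or> Q e)"
  using D0_not[OF D0_conj[OF D0_not D0_not]] by (rule D0_cong) auto

lemma D0_imp: "D0 P \<Longrightarrow> D0 Q \<Longrightarrow> D0 (\<lambda>e. P e \<longrightarrow> Q e)"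
  unfolding imp_conv_disj by (intro D0_disj D0_not)

lemma D0_iff: "D0 P \<Longrightarrow> D0 Q \<Longrightarrow> D0 (\<lambda>e. P e \<longleftrightarrow> Q e)"
  unfolding iff_conv_conj_imp by (intro D0_conj D0_imp)

lemma D0_ex_less:
  assumes "definable_term F" "D0 (\<lambda>e. P (e 0) (\<lambda>n. e (Suc n)))"
  shows "D0 (\<lambda>e. \<exists>a < F e. P a e)"
  using D0_not[OF D0_all_less[OF assms(1) D0_not[OF assms(2)]]] by (rule D0_cong) auto

lemma D0_all_le:
  assumes "definable_term F" "D0 (\<lambda>e. P (e 0) (\<lambda>n. e (Suc n)))"
  shows "D0 (\<lambda>e. \<forall>a \<le> F e. P a e)"
  using D0_all_less[OF definable_term_add[OF assms(1) definable_term_const[of 1]] assms(2)]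
  by (simp add: less_add_one_iff)

lemma D0_ex_le:
  assumes "definable_term F" "D0 (\<lambda>e. P (e 0) (\<lambda>n. e (Suc n)))"
  shows "D0 (\<lambda>e. \<exists>a \<le> F e. P a e)"
  using D0_ex_less[OF definable_term_add[OF assms(1) definable_term_const[of 1]] assms(2)]
  by (simp add: less_add_one_iff)

text \<open>A bound on the quotient makes divisibility a bounded formula. For \<open>x = 0\<close>
  also \<open>y\<close> is 0, and the quotient 0 serves.\<close>

lemma dvd_iff_bounded: "x dvd y \<longleftrightarrow> (\<exists>q \<le> y. y = x * (q :: 'a))"
proof
  assume "x dvd y"
  then obtain q where q: "y = x * q" by blast
  show "\<exists>q \<le> y. y = x * q"
  proof (cases "x = 0")
    case False
    then show ?thesis
      using q le_mult_self[of x q] by (auto simp: mult.commute)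
  qed (use q in auto)
qed auto

lemma definable_term_shift:
  fixes F :: "(nat \<Rightarrow> 'a) \<Rightarrow> 'a"
  assumes "definable_term F"
  shows "definable_term (\<lambda>e. F (\<lambda>n. e (Suc n)))"
proof -
  obtain t q where t: "\<And>e. F e = val (interleave e q) t"
    using assms unfolding definable_term_def by auto
  have "interleave (\<lambda>n. e (Suc n)) q = interleave e q \<circ> (\<lambda>k. if even k then k + 2 else k)"
    for e :: "nat \<Rightarrow> 'a"
    by (auto simp: interleave_def fun_eq_iff)
  then show ?thesis
    unfolding definable_term_def t
    by (intro exI[of _ "rename_tm (\<lambda>k. if even k then k + 2 else k) t"] exI[of _ q])
      (simp only: val_rename_tm simp_thms)
qed

lemma D0_dvd:
  assumes "definable_term F" "definable_term G"
  shows "D0 (\<lambda>e. F e dvd G e)"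
  unfolding dvd_iff_bounded
  by (intro D0_ex_le D0_eq definable_term_mult definable_term_var assms
      assms[THEN definable_term_shift])

text \<open>Under three nested quantifiers the innermost variable is argument 0, so the substitution
  below meets the arguments in reversed order.\<close>

lemma D0_swap:
  assumes "D0 (\<lambda>e. Q (e 0) (e 1) (e 2))"
  shows "D0 (\<lambda>e. Q (e 2) (e 1) (e 0))"
proof -
  obtain \<phi> q s where s: "range s \<subseteq> S"
    and \<phi>: "\<And>e. Q (e 0) (e 1) (e 2) \<longleftrightarrow> sat (interleave e q) s \<phi>"
    using assms unfolding D0_def by auto
  let ?f = "\<lambda>k::nat. if k = 0 then 4 else if k = 4 then 0 else k"
  have inj: "inj ?f"
    by (rule injI) (auto split: if_splits)
  have "interleave e q \<circ> ?f = interleave (e(0 := e 2, 2 := e 0)) q" for e :: "nat \<Rightarrow> 'a"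
    by (auto simp: interleave_def fun_eq_iff elim!: evenE)
  then have "Q (e 2) (e 1) (e 0) \<longleftrightarrow> sat (interleave e q) s (rename_fm ?f id \<phi>)" for e
    using \<phi>[of "e(0 := e 2, 2 := e 0)"] by (simp add: sat_rename_fm[OF inj])
  then show ?thesis
    unfolding D0_def using s by blast
qed

text \<open>Substitution is expressed by quantifiers: each term value is a variable bounded by that
  term and equal to it.\<close>

lemma D0_subst3:
  assumes "D0 (\<lambda>e. Q (e 0) (e 1) (e 2))"
    and "definable_term F" "definable_term G" "definable_term H"
  shows "D0 (\<lambda>e. Q (F e) (G e) (H e))"
proof -
  have "D0 (\<lambda>e. Q (e (Suc (Suc 0))) (e (Suc 0)) (e 0))"
    using D0_swap[OF assms(1)] by (simp add: numeral_2_eq_2)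
  then have "D0 (\<lambda>e. \<exists>a \<le> F e. \<exists>b \<le> G e. \<exists>c \<le> H e. a = F e \<and> b = G e \<and> c = H e \<and> Q a b c)"
    by (intro D0_ex_le D0_eq D0_conj definable_term_var assms
        assms(2-)[THEN definable_term_shift]
        assms(2-)[THEN definable_term_shift, THEN definable_term_shift]
        assms(2-)[THEN definable_term_shift, THEN definable_term_shift, THEN definable_term_shift])
  then show ?thesis
    by (rule D0_cong) auto
qed

lemma D0_subst2:
  assumes "D0 (\<lambda>e. Q (e 0) (e 1))" and "definable_term F" "definable_term G"
  shows "D0 (\<lambda>e. Q (F e) (G e))"
  using D0_subst3[of "\<lambda>a b c. Q a b" F G F] assms by simp

lemma D0_subst1:
  assumes "D0 (\<lambda>e. Q (e 0))" and "definable_term F"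
  shows "D0 (\<lambda>e. Q (F e))"
  using D0_subst3[of "\<lambda>a b c. Q a" F F F] assms by simp

lemmas definable_term_intros =
  definable_term_var definable_term_add definable_term_mult definable_term_const

lemmas D0_intros =
  D0_eq D0_less D0_le D0_dvd D0_not D0_conj D0_disj D0_imp D0_iff
  D0_all_less D0_ex_less D0_all_le D0_ex_le definable_term_intros

lemma definable_term_pair:
  fixes F G :: "(nat \<Rightarrow> 'a) \<Rightarrow> 'a"
  shows "definable_term F \<Longrightarrow> definable_term G \<Longrightarrow> definable_term (\<lambda>e. pair (F e) (G e))"
  unfolding pair_def by (intro definable_term_intros)


section \<open>Induction and comprehension\<close>

lemma interleave_update:
  "(interleave e q)(0 := a, 2 := b) = interleave (e(0 := a, 1 := b)) q"
  by (auto simp: interleave_def fun_eq_iff elim!: evenE)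

lemma Sigma1_induct:
  assumes "D0 (\<lambda>e. Q (e 0) (e 1))"
    and "\<exists>b. Q 0 b" and "\<And>a b. Q a b \<Longrightarrow> \<exists>b. Q (a + 1) b"
  shows "\<exists>b. Q a b"
proof -
  obtain \<phi> q s where s: "range s \<subseteq> S"
    and \<phi>: "\<And>e. Q (e 0) (e 1) \<longleftrightarrow> sat (interleave e q) s \<phi>"
    using assms(1) unfolding D0_def by auto
  \<comment> \<open>Arguments 0 and 1 are the object variables 0 and 2, so the witness is quantified
    at variable 2.\<close>
  have sig: "sat_Sigma1 ((interleave (\<lambda>_. 0) q)(0 := a)) s 2 \<phi> \<longleftrightarrow> (\<exists>b. Q a b)" for a
    unfolding sat_Sigma1_def interleave_update \<phi>[symmetric] by simp
  have "Sigma1_induction S"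
    using model by (simp add: models_RCA0_def)
  then show ?thesis
    using s assms(2,3) sig unfolding Sigma1_induction_def by metis
qed

lemma D0_induct:
  assumes "D0 (\<lambda>e. Q (e 0))" and "Q 0" and "\<And>a. Q a \<Longrightarrow> Q (a + 1)"
  shows "Q a"
proof -
  have "\<exists>b :: 'a. Q a"
    by (rule Sigma1_induct) (use assms in auto)
  then show ?thesis by simp
qed

text \<open>The \<Pi>1 definition is supplied as a \<Sigma>1 definition of the complement; its
  matrix is the negation of \<open>Q\<close>.\<close>

lemma Delta1_comprehension:
  assumes "D0 (\<lambda>e. P (e 0) (e 1))" "D0 (\<lambda>e. Q (e 0) (e 1))"
    and "\<And>a. (\<exists>b. P a b) \<longleftrightarrow> \<not> (\<exists>b. Q a b)"
  shows "{a. \<exists>b. P a b} \<in> S"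
proof -
  obtain \<phi> \<psi> q s where s: "range s \<subseteq> S"
    and \<phi>: "\<And>e. P (e 0) (e 1) \<longleftrightarrow> sat (interleave e q) s \<phi>"
    and \<psi>: "\<And>e. \<not> Q (e 0) (e 1) \<longleftrightarrow> sat (interleave e q) s \<psi>"
    using D0_common[OF assms(1) D0_not[OF assms(2)]] by metis
  have sig: "sat_Sigma1 ((interleave (\<lambda>_. 0) q)(0 := a)) s 2 \<phi> \<longleftrightarrow> (\<exists>b. P a b)" for a
    unfolding sat_Sigma1_def interleave_update \<phi>[symmetric] by simp
  have "sat_Pi1 ((interleave (\<lambda>_. 0) q)(0 := a)) s 2 \<psi> \<longleftrightarrow> (\<exists>b. P a b)" for a
    unfolding sat_Pi1_def interleave_update \<psi>[symmetric] using assms(3) by simp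
  then obtain X where "X \<in> S" "\<And>a. a \<in> X \<longleftrightarrow> (\<exists>b. P a b)"
    using model s sig unfolding models_RCA0_def Delta1_comprehension_def by metis
  moreover from this have "X = {a. \<exists>b. P a b}"
    by auto
  ultimately show ?thesis by simp
qed

lemma D0_comprehension:
  assumes "D0 (\<lambda>e. P (e 0))"
  shows "{a. P a} \<in> S"
  using Delta1_comprehension[of "\<lambda>a b. P a" "\<lambda>a b. \<not> P a"] assms D0_not by auto

lemma UNIV_mem: "UNIV \<in> S"
proof -
  have "D0 (\<lambda>e. e 0 = e 0)"
    by (intro D0_intros)
  from D0_comprehension[of "\<lambda>a. a = a", OF this] show ?thesis
    by simp
qed

lemma less_induct_mem:
  assumes "X \<in> S" and "\<And>a. (\<And>b. b < a \<Longrightarrow> b \<in> X) \<Longrightarrow> a \<in> X"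
  shows "a \<in> X"
proof -
  have "\<forall>b < a. b \<in> X" for a
  proof (rule D0_induct[where Q = "\<lambda>a. \<forall>b < a. b \<in> X"])
    show "D0 (\<lambda>e. \<forall>b < e 0. b \<in> X)"
      by (intro D0_intros D0_mem assms(1))
  qed (use assms(2) in \<open>auto simp: less_add_one_iff le_less\<close>)
  then show ?thesis using assms(2) by blast
qed

text \<open>A common bound contracts two unbounded quantifiers to one, the form that
  \<open>Sigma1_induct\<close> accepts.\<close>

lemma ex_ex_bounded: "(\<exists>x w. P x w) \<longleftrightarrow> (\<exists>b. \<exists>x \<le> b. \<exists>w \<le> b. P x (w :: 'a))"
proof
  assume "\<exists>x w. P x w"
  then obtain x w where "P x w" by blast
  then show "\<exists>b. \<exists>x \<le> b. \<exists>w \<le> b. P x w"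
    using max.cobounded1[of x w] max.cobounded2[of w x] by blast
qed blast

text \<open>Without a greatest element, \<Sigma>1 induction on \<open>k\<close> gives an element
  that is at least \<open>k\<close> for every \<open>k\<close>, which contradicts the bound at
  \<open>B + 1\<close>.\<close>

lemma ex_max_Sigma1:
  assumes "D0 (\<lambda>e. Q (e 0) (e 1))" and "Q a w" and "\<And>a w. Q a w \<Longrightarrow> a \<le> B"
  obtains m w where "Q m w" "\<And>b v. Q b v \<Longrightarrow> b \<le> m"
proof (rule ccontr)
  note obt = that
  assume no: "\<not> thesis"
  have "\<exists>b. \<exists>x \<le> b. \<exists>w \<le> b. k \<le> x \<and> Q x w" for k
  proof (rule Sigma1_induct[where Q = "\<lambda>k b. \<exists>x \<le> b. \<exists>w \<le> b. k \<le> x \<and> Q x w"], goal_cases)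
    case 1
    show ?case
      by (intro D0_intros D0_subst2[OF assms(1)])
  next
    case 2
    show ?case
      using assms(2) unfolding ex_ex_bounded[symmetric] by auto
  next
    case (3 k b)
    then obtain x w where x: "k \<le> x" "Q x w" by blast
    obtain y v where "Q y v" "\<not> y \<le> x"
      using no obt[OF \<open>Q x w\<close>] by blast
    with x show ?case
      unfolding ex_ex_bounded[symmetric] add_one_le_iff by (meson le_less_trans not_le)
  qed
  then have "\<exists>x w. B + 1 \<le> x \<and> Q x w"
    unfolding ex_ex_bounded[symmetric] .
  then show False
    using assms(3) by (auto simp: add_one_le_iff not_le[symmetric])
qed

lemma ex_max:
  assumes "X \<in> S" "a \<in> X" "\<And>b. b \<in> X \<Longrightarrow> b \<le> B"
  obtains m where "m \<in> X" "\<And>b. b \<in> X \<Longrightarrow> b \<le> m"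
proof -
  have "D0 (\<lambda>e. e 0 \<in> X)"
    by (intro D0_mem definable_term_var assms)
  then show thesis
  proof (rule ex_max_Sigma1[where Q = "\<lambda>x w. x \<in> X"])
    show "a \<in> X" "\<And>b. b \<in> X \<Longrightarrow> b \<le> B"
      by fact+
  qed (rule that)
qed

section \<open>Codes for finite sets\<close>

text \<open>The moduli are those of Goedel's beta function: below \<open>n\<close> they are pairwise
  coprime once \<open>m\<close> is divisible by \<open>1, ..., n\<close>. A code is a product of the
  moduli of its elements.\<close>

definition codeset :: "'a \<Rightarrow> 'a \<Rightarrow> 'a set" where
  "codeset m a = {x. (x + 1) * m + 1 dvd a}"

lemma D0_codeset:
  assumes "definable_term F" "definable_term M" "definable_term A"
  shows "D0 (\<lambda>e. F e \<in> codeset (M e) (A e))"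
  unfolding codeset_def mem_Collect_eq by (intro D0_intros assms)

text \<open>Products of variable length are not terms of the language; \<Sigma>1 induction on
  \<open>n\<close>, multiplying by \<open>g n\<close> at each step, replaces them.\<close>

lemma ex_common_multiple:
  fixes g :: "'a \<Rightarrow> 'a"
  assumes "definable_term (\<lambda>e. g (e 0))" and "\<And>x. g x \<noteq> 0"
  obtains b where "b \<noteq> 0" "\<And>x. x < n \<Longrightarrow> g x dvd b"
proof -
  have "\<exists>b. b \<noteq> 0 \<and> (\<forall>x < n. g x dvd b)"
  proof (rule Sigma1_induct[where Q = "\<lambda>n b. b \<noteq> 0 \<and> (\<forall>x < n. g x dvd b)"], goal_cases)
    case 1
    show ?case by (intro D0_intros assms(1))
  next
    case (3 n b)
    then have "b * g n \<noteq> 0" "\<forall>x < n + 1. g x dvd b * g n"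
      using assms(2) by (auto simp: less_add_one_iff le_less)
    then show ?case by blast
  next
    case 2
    show ?case by (rule exI[of _ 1]) simp
  qed
  then show thesis using that by blast
qed

text \<open>
  The explicit Bezout identity
  \<open>1 + (x+1)(y+1)e p\<^sub>x = p\<^sub>x + (x+1)\<^sup>2 e p\<^sub>y\<close>, where \<open>p\<^sub>x = (x+1)m + 1\<close> and \<open>m = (y - x) e\<close>,
  replaces a theory of greatest common divisors.
\<close>

lemma modulus_bezout:
  fixes x d e :: 'a
  shows "1 + x * (x + d) * e * (x * (d * e) + 1) =
    (x * (d * e) + 1) + x * x * e * ((x + d) * (d * e) + 1)"
  by (simp only: distrib_left distrib_right mult_1_left mult_1_right ac_simps)

text \<open>The difference of \<open>y\<close> and \<open>x\<close> is \<open>k + 1\<close> for some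
  \<open>k < n\<close>, hence divides \<open>m\<close>; the quotient is the \<open>e\<close> of the
  identity.\<close>

lemma ex_modulus_bezout:
  fixes x y n m :: 'a
  assumes m: "\<And>k. k < n \<Longrightarrow> k + 1 dvd m" and "x < y" "y < n"
  obtains u w where "1 + u * ((x + 1) * m + 1) = ((x + 1) * m + 1) + w * ((y + 1) * m + 1)"
proof -
  obtain d where d: "y = x + d"
    using less_imp_le[OF \<open>x < y\<close>] unfolding le_iff_add by blast
  with \<open>x < y\<close> have "0 < d" by simp
  then have "1 \<le> d"
    using add_one_le_iff[of 0 d] by simp
  then obtain k where k: "d = k + 1"
    by (auto simp: le_iff_add add.commute)
  have "k < d" "d \<le> y"
    using k d by (auto simp: less_add_one_iff add_increasing)
  then have "k < n"
    using \<open>y < n\<close> by (meson less_le_trans less_trans)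
  then obtain e where "m = d * e"
    using m[of k] k by auto
  then show thesis
    using that[of "(x + 1) * (x + 1 + d) * e" "(x + 1) * (x + 1) * e"] modulus_bezout[of "x + 1" d e]
    unfolding d by (simp only: add.assoc add.commute[of d 1])
qed

lemma bezout_dvd:
  fixes p q a u w :: 'a
  assumes "1 + u * p = p + w * q"
  shows "p dvd a * q \<Longrightarrow> p dvd a" and "q dvd a * p \<Longrightarrow> q dvd a"
proof -
  have "a * (1 + u * p) = a * (p + w * q)"
    using assms by simp
  \<comment> \<open>Every term except the lone \<open>a\<close> is divisible by \<open>p\<close>,
    respectively by \<open>q\<close>, under the corresponding premise.\<close>
  then have eq: "u * (a * p) + a = a * p + w * (a * q)"
    by (simp only: distrib_left mult_1_left mult_1_right ac_simps)
  show "p dvd a" if "p dvd a * q"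
  proof -
    have "p dvd u * (a * p) + a" "p dvd u * (a * p)"
      unfolding eq using that by simp_all
    then show ?thesis by (simp only: dvd_add_right_iff)
  qed
  show "q dvd a" if "q dvd a * p"
  proof -
    have "q dvd u * (a * p) + a" "q dvd u * (a * p)"
      unfolding eq using that by simp_all
    then show ?thesis by (simp only: dvd_add_right_iff)
  qed
qed

lemma modulus_dvd_mult:
  fixes x y n m :: 'a
  assumes m: "\<And>k. k < n \<Longrightarrow> k + 1 dvd m" and "x < n" "y < n" "x \<noteq> y"
    and dvd: "(x + 1) * m + 1 dvd a * ((y + 1) * m + 1)"
  shows "(x + 1) * m + 1 dvd a"
proof (cases "x < y")
  case True
  then obtain u w where
    "1 + u * ((x + 1) * m + 1) = ((x + 1) * m + 1) + w * ((y + 1) * m + 1)"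
    using ex_modulus_bezout[OF m _ \<open>y < n\<close>] by metis
  then show ?thesis
    using dvd by (rule bezout_dvd(1))
next
  case False
  then have "y < x" using \<open>x \<noteq> y\<close> by simp
  then obtain u w where
    "1 + u * ((y + 1) * m + 1) = ((y + 1) * m + 1) + w * ((x + 1) * m + 1)"
    using ex_modulus_bezout[OF m _ \<open>x < n\<close>] by metis
  then show ?thesis
    using dvd by (rule bezout_dvd(2))
qed

text \<open>Invariant for building codes: \<open>a\<close> divides a fixed \<open>B\<close>, and the
  cofactor still contains the modulus of every element not yet coded. All such codes are therefore
  at most \<open>B\<close> when \<open>B\<close> is not 0.\<close>

definition splits :: "'a \<Rightarrow> 'a \<Rightarrow> 'a \<Rightarrow> 'a \<Rightarrow> bool" where
  "splits n m B a \<longleftrightarrow>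
    (\<exists>q \<le> B. B = a * q \<and> (\<forall>y < n. y \<notin> codeset m a \<longrightarrow> (y + 1) * m + 1 dvd q))"

lemma D0_splits:
  assumes "definable_term A"
  shows "D0 (\<lambda>e. splits n m B (A e))"
  by (rule D0_subst1[where Q = "splits n m B", OF _ assms])
    (unfold splits_def, intro D0_intros D0_codeset)

text \<open>The modulus of \<open>x\<close> moves from the cofactor into the code. Coprimality of
  the moduli leaves the membership of every other \<open>y\<close> unchanged and keeps the missing
  moduli in the cofactor.\<close>

lemma splits_insert:
  assumes m: "\<And>k. k < n \<Longrightarrow> k + 1 dvd m" "m \<noteq> 0" and "B \<noteq> 0" "splits n m B a"
    and x: "x < n" "x \<notin> codeset m a"
  obtains a' where "a < a'" "splits n m B a'"
    "\<And>y. y < n \<Longrightarrow> y \<in> codeset m a' \<longleftrightarrow> y = x \<or> y \<in> codeset m a"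
proof -
  let ?p = "\<lambda>y. (y + 1) * m + 1"
  obtain q where q: "B = a * q" "\<And>y. y < n \<Longrightarrow> y \<notin> codeset m a \<Longrightarrow> ?p y dvd q"
    using assms(4) unfolding splits_def by blast
  obtain r where r: "q = ?p x * r"
    using q(2)[OF x] by blast
  let ?a = "a * ?p x"
  have mem: "y \<in> codeset m ?a \<longleftrightarrow> y = x \<or> y \<in> codeset m a" if "y < n" for y
  proof (cases "y = x")
    case False
    then show ?thesis
      using modulus_dvd_mult[OF m(1) that x(1) False, of a] by (auto simp: codeset_def)
  qed (simp add: codeset_def)
  have B: "B = ?a * r"
    using q r by (simp only: ac_simps)
  have "?p y dvd r" if "y < n" "y \<notin> codeset m ?a" for y
  proof -
    have "y \<noteq> x" "?p y dvd q"
      using mem q(2) that by auto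
    then show ?thesis
      using modulus_dvd_mult[OF m(1) that(1) x(1), of r] r by (simp only: ac_simps simp_thms)
  qed
  moreover have "r \<le> B"
    using B \<open>B \<noteq> 0\<close> le_mult_self[of ?a r] by (metis mult.commute mult_zero_left)
  ultimately have "splits n m B ?a"
    unfolding splits_def using B by blast
  moreover have "a < ?a"
  proof -
    have "a \<noteq> 0" using q \<open>B \<noteq> 0\<close> by auto
    then have "0 < a * ((x + 1) * m)"
      using m(2) by (simp add: zero_less_iff_neq_zero)
    then have "a < a * ((x + 1) * m) + a"
      by simp
    also have "\<dots> = ?a"
      by (simp only: distrib_left mult_1_right)
    finally show ?thesis .
  qed
  ultimately show thesis
    using that mem by blast
qed

text \<open>\<open>B\<close> is a common multiple of all moduli below \<open>n\<close>, so the code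
  1 has cofactor \<open>B\<close>. As \<open>m\<close> is not 0, every modulus exceeds 1 and the
  code 1 stands for the empty set.\<close>

lemma ex_code_bound:
  obtains m B where "\<And>k. k < n \<Longrightarrow> k + 1 dvd m" "m \<noteq> 0" "B \<noteq> 0" "splits n m B 1" "codeset m 1 = {}"
proof -
  have "definable_term (\<lambda>e :: nat \<Rightarrow> 'a. e 0 + 1)"
    by (intro definable_term_intros)
  then obtain m where m: "m \<noteq> 0" "\<And>k. k < n \<Longrightarrow> k + 1 dvd m"
    by (rule ex_common_multiple[where n = n]) auto
  have "definable_term (\<lambda>e :: nat \<Rightarrow> 'a. (e 0 + 1) * m + 1)"
    by (intro definable_term_intros)
  then obtain B where B: "B \<noteq> 0" "\<And>k. k < n \<Longrightarrow> (k + 1) * m + 1 dvd B"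
    by (rule ex_common_multiple[where n = n]) auto
  have "\<not> (x + 1) * m + 1 dvd 1" for x
  proof
    assume "(x + 1) * m + 1 dvd 1"
    then obtain q where q: "1 = ((x + 1) * m + 1) * q" by blast
    then have "q \<noteq> 0" by auto
    then have "(x + 1) * m + 1 \<le> 1"
      using le_mult_self[of q "(x + 1) * m + 1"] q by simp
    then show False
      using m(1) by simp
  qed
  then have "codeset m 1 = {}"
    by (auto simp: codeset_def)
  then show thesis
    using that m B by (auto simp: splits_def)
qed

text \<open>One bound \<open>B\<close> for all \<open>X\<close> expresses that there are only
  finitely many strings of length \<open>n\<close>. The code of a given \<open>X\<close> is built by
  \<Sigma>1 induction, one element at a time.\<close>

lemma uniform_codes:
  obtains m B where "\<And>X. X \<in> S \<Longrightarrow> \<exists>a \<le> B. \<forall>x < n. x \<in> codeset m a \<longleftrightarrow> x \<in> X"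
proof -
  obtain m B where m: "\<And>k. k < n \<Longrightarrow> k + 1 dvd m" "m \<noteq> 0" and B: "B \<noteq> 0" "splits n m B 1"
    and 1: "codeset m 1 = {}"
    using ex_code_bound by metis
  have le: "a \<le> B" if "splits n m B a" for a
    using that B(1) unfolding splits_def by (auto intro!: le_mult_self)
  have "\<exists>a \<le> B. \<forall>x < n. x \<in> codeset m a \<longleftrightarrow> x \<in> X" if X: "X \<in> S" for X
  proof -
    define Q where "Q = (\<lambda>k a. splits n m B a \<and> (\<forall>x < n. x \<in> codeset m a \<longleftrightarrow> x < k \<and> x \<in> X))"
    have "\<exists>a. Q n a"
    proof (rule Sigma1_induct)
      show "D0 (\<lambda>e. Q (e 0) (e 1))"
        unfolding Q_def by (intro D0_intros D0_codeset D0_splits D0_mem X)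
      show "\<exists>a. Q 0 a"
        unfolding Q_def using B(2) 1 by auto
      show "\<exists>a. Q (k + 1) a" if "Q k a" for k a
      proof (cases "k < n \<and> k \<in> X")
        case True
        then have "k \<notin> codeset m a"
          using that by (auto simp: Q_def)
        with True that obtain a' where "splits n m B a'"
          "\<And>y. y < n \<Longrightarrow> y \<in> codeset m a' \<longleftrightarrow> y = k \<or> y \<in> codeset m a"
          using splits_insert[OF m B(1)] unfolding Q_def by metis
        then have "Q (k + 1) a'"
          using that True by (auto simp: Q_def less_add_one_iff)
        then show ?thesis by blast
      next
        case False
        then have "Q (k + 1) a"
          using that by (auto simp: Q_def less_add_one_iff le_less)
        then show ?thesis by blast
      qed
    qed
    then show ?thesis
      using le unfolding Q_def by blast
  qed
  then show thesis using that by blast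
qed

text \<open>Among the codes of sets of \<open>x < n\<close> whose elements have witnesses up to a
  common \<open>w\<close>, take the greatest. An \<open>x\<close> with a witness but none up to
  \<open>w\<close> could be inserted, giving a greater code; so \<open>w\<close> is the
  bound.\<close>

lemma strong_Sigma1_bounding:
  assumes "D0 (\<lambda>e. Q (e 0) (e 1))"
  obtains z where "\<And>x y. x < n \<Longrightarrow> Q x y \<Longrightarrow> \<exists>y \<le> z. Q x y"
proof -
  obtain m B where m: "\<And>k. k < n \<Longrightarrow> k + 1 dvd m" "m \<noteq> 0" and B: "B \<noteq> 0" "splits n m B 1"
    and 1: "codeset m 1 = {}"
    using ex_code_bound by metis
  have le: "a \<le> B" if "splits n m B a" for a
    using that B(1) unfolding splits_def by (auto intro!: le_mult_self)
  define R where "R = (\<lambda>a w. splits n m B a \<and> (\<forall>x < n. x \<in> codeset m a \<longrightarrow> (\<exists>y \<le> w. Q x y)))"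
  have "D0 (\<lambda>e. R (e 0) (e 1))"
    unfolding R_def by (intro D0_intros D0_splits D0_codeset D0_subst2[OF assms])
  moreover have "R 1 0"
    using B 1 by (simp add: R_def)
  moreover have "a \<le> B" if "R a w" for a w
    using that le by (simp add: R_def)
  ultimately obtain a w where a: "R a w" and max: "\<And>b v. R b v \<Longrightarrow> b \<le> a"
    using ex_max_Sigma1[of R] by metis
  show thesis
  proof (rule that, rule ccontr)
    fix x y
    assume x: "x < n" "Q x y" and no: "\<not> (\<exists>y \<le> w. Q x y)"
    then have "x \<notin> codeset m a"
      using a by (auto simp: R_def)
    then obtain a' where a': "a < a'" "splits n m B a'"
      "\<And>y. y < n \<Longrightarrow> y \<in> codeset m a' \<longleftrightarrow> y = x \<or> y \<in> codeset m a"
      using splits_insert[OF m B(1) _ x(1)] a unfolding R_def by metis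
    have "\<exists>v \<le> max y w. Q z v" if "z < n" "z \<in> codeset m a'" for z
      using that a'(3)[OF that(1)] a x unfolding R_def by (auto simp: le_max_iff_disj)
    then have "R a' (max y w)"
      using a'(2) by (simp add: R_def)
    then show False
      using max a'(1) by (auto simp: not_le[symmetric])
  qed
qed

section \<open>Recursion on the order\<close>

text \<open>Course-of-values recursion: coded approximations exist for every length by \<Sigma>1
  induction and agree with each other by induction along the order.\<close>

lemma recursive_set:
  assumes local: "\<And>y X Y. (\<And>x. x < y \<Longrightarrow> x \<in> X \<longleftrightarrow> x \<in> Y) \<Longrightarrow> \<Phi> y X \<longleftrightarrow> \<Phi> y Y"
    and "D0 (\<lambda>e. \<Phi> (e 0) (codeset (e 1) (e 2)))"
  obtains H where "H \<in> S" "\<And>y. y \<in> H \<longleftrightarrow> \<Phi> y H"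
proof -
  note D0_\<Phi> = D0_subst3[where Q = "\<lambda>y m a. \<Phi> y (codeset m a)", OF assms(2)]
  define good where "good = (\<lambda>n m a. \<forall>y < n. y \<in> codeset m a \<longleftrightarrow> \<Phi> y (codeset m a))"
  have "D0 (\<lambda>e. good (e 0) (e 1) (e 2))"
    unfolding good_def by (intro D0_intros D0_codeset D0_\<Phi>)
  note D0_good = D0_subst3[where Q = good, OF this]
  have ex: "\<exists>m a. good n m a" for n
  proof (subst ex_ex_bounded,
      rule Sigma1_induct[where Q = "\<lambda>n b. \<exists>m \<le> b. \<exists>a \<le> b. good n m a"], goal_cases)
    case 1
    show ?case by (intro D0_intros D0_good)
  next
    case 2
    show ?case by (auto simp: good_def)
  next
    case (3 n b)
    then obtain m a where good: "good n m a" by blast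
    \<comment> \<open>The approximation is cut off at \<open>n\<close> and extended by the decision
      at \<open>n\<close>; \<open>uniform_codes\<close> then provides a code for the result.\<close>
    define X where "X = {x. x < n \<and> x \<in> codeset m a \<or> x = n \<and> \<Phi> n (codeset m a)}"
    have "X \<in> S"
      unfolding X_def by (intro D0_comprehension D0_intros D0_codeset D0_\<Phi>)
    then obtain m' a' where eq: "\<And>x. x < n + 1 \<Longrightarrow> x \<in> codeset m' a' \<longleftrightarrow> x \<in> X"
      using uniform_codes[of "n + 1"] by metis
    have "y \<in> codeset m' a' \<longleftrightarrow> \<Phi> y (codeset m' a')" if "y < n + 1" for y
    proof -
      have "y \<le> n" using that by (simp add: less_add_one_iff)
      then have "x \<in> codeset m' a' \<longleftrightarrow> x \<in> codeset m a" if "x < y" for x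
        using eq[of x] that by (auto simp: X_def less_add_one_iff)
      then have "\<Phi> y (codeset m' a') \<longleftrightarrow> \<Phi> y (codeset m a)"
        by (rule local)
      then show ?thesis
        using eq[OF that] good \<open>y \<le> n\<close> by (auto simp: X_def good_def le_less)
    qed
    then have "good (n + 1) m' a'"
      by (simp add: good_def)
    then show ?case
      unfolding ex_ex_bounded[symmetric] by blast
  qed
  have uniq: "y \<in> codeset m a \<longleftrightarrow> y \<in> codeset m' a'"
    if "good n m a" "good n' m' a'" "y < n" "y < n'" for n n' m m' a a' y
  proof -
    have "{y. y < n \<and> y < n' \<longrightarrow> (y \<in> codeset m a \<longleftrightarrow> y \<in> codeset m' a')} \<in> S" (is "?X \<in> S")
      by (intro D0_comprehension D0_intros D0_codeset)
    then have "y \<in> ?X"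
    proof (rule less_induct_mem)
      fix z assume IH: "\<And>x. x < z \<Longrightarrow> x \<in> ?X"
      show "z \<in> ?X"
      proof (clarify)
        assume "z < n" "z < n'"
        then have "\<Phi> z (codeset m a) \<longleftrightarrow> \<Phi> z (codeset m' a')"
          using IH by (intro local) (auto dest: less_trans)
        then show "z \<in> codeset m a \<longleftrightarrow> z \<in> codeset m' a'"
          using that(1,2) \<open>z < n\<close> \<open>z < n'\<close> by (auto simp: good_def)
      qed
    qed
    then show ?thesis using that(3,4) by blast
  qed
  \<comment> \<open>Membership of \<open>y\<close> can be read off any approximation of length
    \<open>y + 1\<close>. The same search for a negative answer defines the complement, so the set
    belongs to the model.\<close>
  define H where "H = {y. \<exists>b. \<exists>m \<le> b. \<exists>a \<le> b. good (y + 1) m a \<and> y \<in> codeset m a}"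
  have mem: "y \<in> H \<longleftrightarrow> y \<in> codeset m a" if "good n m a" "y < n" for n m a y
    unfolding H_def mem_Collect_eq ex_ex_bounded[symmetric]
    using uniq[OF that(1)] that(2) ex[of "y + 1"] by (metis less_add_one_iff order_refl)
  have "H \<in> S"
    unfolding H_def
  proof (rule Delta1_comprehension)
    show "D0 (\<lambda>e. \<exists>m \<le> e 1. \<exists>a \<le> e 1. good (e 0 + 1) m a \<and> e 0 \<in> codeset m a)"
      by (intro D0_intros D0_codeset D0_good)
    show "D0 (\<lambda>e. \<exists>m \<le> e 1. \<exists>a \<le> e 1. good (e 0 + 1) m a \<and> e 0 \<notin> codeset m a)"
      by (intro D0_intros D0_codeset D0_good)
    show "(\<exists>b. \<exists>m \<le> b. \<exists>a \<le> b. good (y + 1) m a \<and> y \<in> codeset m a) \<longleftrightarrow>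
      \<not> (\<exists>b. \<exists>m \<le> b. \<exists>a \<le> b. good (y + 1) m a \<and> y \<notin> codeset m a)" for y
      unfolding ex_ex_bounded[symmetric]
      using uniq ex[of "y + 1"] by (metis less_add_one_iff order_refl)
  qed
  moreover have "y \<in> H \<longleftrightarrow> \<Phi> y H" for y
  proof -
    obtain m a where good: "good (y + 1) m a"
      using ex by blast
    then have "\<Phi> y H \<longleftrightarrow> \<Phi> y (codeset m a)"
      by (intro local mem[OF good]) (auto simp: less_add_one_iff)
    then show ?thesis
      using mem[OF good, of y] good by (simp add: good_def less_add_one_iff)
  qed
  ultimately show thesis using that by blast
qed

text \<open>
  The sequence is searched for among pairs of an element and a witness, so that the property
  \<open>\<exists>w. A x w\<close> imposed on its elements may be properly \<open>\<Sigma>\<^sub>1\<close>.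
\<close>

lemma greedy_sequence:
  assumes A: "D0 (\<lambda>e. A (e 0) (e 1))" and C: "D0 (\<lambda>e. C (e 0) (e 1))"
    and extend: "\<And>n F. \<lbrakk>F \<in> S; \<And>x. x \<in> F \<Longrightarrow> x \<le> n \<and> (\<exists>w. A x w);
      \<And>x y. \<lbrakk>x \<in> F; y \<in> F; x < y\<rbrakk> \<Longrightarrow> C x y\<rbrakk> \<Longrightarrow> \<exists>x w. n < x \<and> A x w \<and> (\<forall>y \<in> F. C y x)"
  obtains I where "I \<in> S" "unbounded I" "\<And>x. x \<in> I \<Longrightarrow> \<exists>w. A x w"
    "\<And>x y. \<lbrakk>x \<in> I; y \<in> I; x < y\<rbrakk> \<Longrightarrow> C x y"
proof -
  \<comment> \<open>A code enters \<open>K\<close> if its element is greater than, and in relation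
    \<open>C\<close> to, the elements of all earlier codes in \<open>K\<close>. Elements thus
    increase with their codes.\<close>
  define \<Phi> where "\<Phi> = (\<lambda>u K. \<exists>x \<le> u. \<exists>w \<le> u. u = pair x w \<and> A x w \<and>
    (\<forall>v < u. v \<in> K \<longrightarrow> (\<forall>y \<le> v. \<forall>z \<le> v. v = pair y z \<longrightarrow> y < x \<and> C y x)))"
  have def: "D0 (\<lambda>e. \<Phi> (e 0) (codeset (e 1) (e 2)))"
    unfolding \<Phi>_def
    by (intro D0_intros definable_term_pair D0_codeset D0_subst2[OF A] D0_subst2[OF C])
  have local: "\<Phi> y X \<longleftrightarrow> \<Phi> y Y" if "\<And>x. x < y \<Longrightarrow> x \<in> X \<longleftrightarrow> x \<in> Y" for y X Y
    unfolding \<Phi>_def using that by simp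
  obtain K where K: "K \<in> S" and K_iff: "\<And>u. u \<in> K \<longleftrightarrow> \<Phi> u K"
  proof (rule recursive_set[of \<Phi>])
    show "\<Phi> y X \<longleftrightarrow> \<Phi> y Y" if "\<And>x. x < y \<Longrightarrow> x \<in> X \<longleftrightarrow> x \<in> Y" for y X Y
      using that by (rule local)
  qed (rule def, rule that)
  have K_pair: "\<exists>x w. u = pair x w \<and> A x w" if "u \<in> K" for u
    using that unfolding K_iff[of u] \<Phi>_def by blast
  have K_less: "x < y \<and> C x y" if "pair x w \<in> K" "pair y z \<in> K" "pair x w < pair y z" for x y w z
    using that(2) unfolding K_iff[of "pair y z"] \<Phi>_def
    using that(1,3) le_pair(1)[of x w] le_pair(2)[of w x] by (auto simp: pair_eq_iff)
  have K_less': "pair x w < pair y z" if "pair x w \<in> K" "pair y z \<in> K" "x < y" for x y w z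
    using K_less[OF that(2,1)] that(3) by (metis linorder_neqE order.asym pair_eq_iff)
  have K_unbounded: "\<exists>u \<in> K. n < u" for n
  proof (rule ccontr)
    assume no: "\<not> ?thesis"
    \<comment> \<open>If all codes in \<open>K\<close> were at most \<open>n\<close>, this would
      collect all their elements. The extension hypothesis then gives \<open>x > n\<close>, whose
      code would enter \<open>K\<close>.\<close>
    define F where "F = {x. \<exists>u \<le> n. u \<in> K \<and> (\<exists>w \<le> u. u = pair x w)}"
    have F_iff: "x \<in> F \<longleftrightarrow> (\<exists>w. pair x w \<in> K)" for x
      unfolding F_def using no le_pair(2) by (auto simp: not_less) blast
    have "F \<in> S"
      unfolding F_def by (intro D0_comprehension D0_intros definable_term_pair D0_mem K)
    moreover have "x \<le> n \<and> (\<exists>w. A x w)" if x: "x \<in> F" for x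
    proof -
      obtain w where w: "pair x w \<in> K" using x F_iff by blast
      then have "pair x w \<le> n" using no by (auto simp: not_less)
      then show ?thesis
        using K_pair[OF w] le_pair(1)[of x w] by (auto simp: pair_eq_iff)
    qed
    moreover have "C x y" if "x \<in> F" "y \<in> F" "x < y" for x y
      using that K_less K_less' unfolding F_iff by blast
    ultimately obtain x w where x: "n < x" "A x w" "\<forall>y \<in> F. C y x"
      using extend[of F n] by blast
    have "y < x \<and> C y x" if "pair y z \<in> K" for y z
    proof -
      have "pair y z \<le> n" using no that by (auto simp: not_less)
      then have "y < x"
        using le_pair(1)[of y z] x(1) by (meson le_less_trans order_trans)
      then show ?thesis
        using x(3) that F_iff by blast
    qed
    then have "\<Phi> (pair x w) K"
      unfolding \<Phi>_def using le_pair(1)[of x w] le_pair(2)[of w x] x(2) by blast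
    then have "pair x w \<in> K"
      using K_iff by blast
    then show False
      using no x(1) le_pair(1)[of x w] by (meson less_le_trans)
  qed
  \<comment> \<open>Unboundedness passes from the codes to the elements by induction, since a later
    code has a strictly greater element.\<close>
  have large: "\<exists>u. u \<in> K \<and> (\<exists>x \<le> u. \<exists>w \<le> u. u = pair x w \<and> n \<le> x)" for n
  proof (rule Sigma1_induct[where
        Q = "\<lambda>n u. u \<in> K \<and> (\<exists>x \<le> u. \<exists>w \<le> u. u = pair x w \<and> n \<le> x)"], goal_cases)
    case 1
    show ?case by (intro D0_intros definable_term_pair D0_mem K)
  next
    case 2
    obtain u where "u \<in> K" using K_unbounded by blast
    then show ?case using K_pair le_pair by (metis zero_le)
  next
    case (3 n u)
    then obtain x w where u: "u = pair x w" "u \<in> K" "n \<le> x" by blast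
    obtain v where v: "v \<in> K" "u < v" using K_unbounded by blast
    obtain y z where yz: "v = pair y z" using K_pair[OF v(1)] by blast
    then have "n + 1 \<le> y"
      using K_less[of x w y z] u v unfolding add_one_le_iff by auto
    then show ?case
      using v(1) yz le_pair by blast
  qed
  define I where "I = {x. \<exists>w. pair x w \<in> K}"
  have "I \<in> S"
    unfolding I_def
  proof (rule Delta1_comprehension)
    \<comment> \<open>As elements increase with codes, \<open>x\<close> is absent as soon as a code
      in \<open>K\<close> with a greater element is reached without meeting
      \<open>x\<close>.\<close>
    let ?Q = "\<lambda>x u. u \<in> K \<and> (\<exists>y \<le> u. \<exists>z \<le> u. u = pair y z \<and> x < y) \<and>
      (\<forall>v < u. v \<in> K \<longrightarrow> (\<forall>z \<le> v. v \<noteq> pair x z))"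
    show "D0 (\<lambda>e. pair (e 0) (e 1) \<in> K)"
      by (intro D0_intros definable_term_pair D0_mem K)
    show "D0 (\<lambda>e. ?Q (e 0) (e 1))"
      by (intro D0_intros definable_term_pair D0_mem K)
    show "(\<exists>w. pair x w \<in> K) \<longleftrightarrow> \<not> (\<exists>u. ?Q x u)" for x
    proof
      assume "\<exists>w. pair x w \<in> K"
      then show "\<not> (\<exists>u. ?Q x u)"
        using K_less' le_pair(2) by blast
    next
      assume no: "\<not> (\<exists>u. ?Q x u)"
      obtain u y z where u: "u \<in> K" "u = pair y z" "x + 1 \<le> y"
        using large[of "x + 1"] by blast
      then have "\<exists>y \<le> u. \<exists>z \<le> u. u = pair y z \<and> x < y"
        unfolding add_one_le_iff using le_pair by blast
      then show "\<exists>w. pair x w \<in> K"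
        using no u(1) by blast
    qed
  qed
  moreover have "unbounded I"
    unfolding unbounded_def
  proof
    fix n
    obtain y z where "pair y z \<in> K" "n + 1 \<le> y"
      using large[of "n + 1"] by blast
    then show "\<exists>x \<in> I. n < x"
      unfolding I_def add_one_le_iff by blast
  qed
  moreover have "\<exists>w. A x w" if "x \<in> I" for x
    using that K_pair[of "pair x _"] unfolding I_def by (auto simp: pair_eq_iff)
  moreover have "C x y" if "x \<in> I" "y \<in> I" "x < y" for x y
    using that K_less K_less' unfolding I_def by blast
  ultimately show thesis using that by blast
qed

section \<open>Graphs and the weak Rival--Sands theorem\<close>

definition adj :: "'a set \<Rightarrow> 'a \<Rightarrow> 'a \<Rightarrow> bool" where
  "adj E x y \<longleftrightarrow> x < y \<and> pair x y \<in> E \<or> y < x \<and> pair y x \<in> E"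

lemma adj_commute: "adj E x y \<longleftrightarrow> adj E y x"
  by (auto simp: adj_def)

lemma adj_imp_neq: "adj E x y \<Longrightarrow> x \<noteq> y"
  by (auto simp: adj_def)

lemma adj_less: "x < y \<Longrightarrow> adj E x y \<longleftrightarrow> pair x y \<in> E"
  by (auto simp: adj_def)

lemma D0_adj:
  assumes "E \<in> S" "definable_term F" "definable_term G"
  shows "D0 (\<lambda>e. adj E (F e) (G e))"
  unfolding adj_def by (intro D0_intros D0_mem definable_term_pair assms)

lemma nbhd_eq_adj:
  assumes "graph V E"
  shows "nbhd V E x = {y. adj E x y}"
proof -
  have E: "a \<in> V \<and> b \<in> V \<and> a < b" if "pair a b \<in> E" for a b
    using assms that unfolding graph_def two_subsets_eq by (force simp: pair_eq_iff)
  have "upair x y \<in> E \<longleftrightarrow> adj E x y" for y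
  proof (cases x y rule: linorder_cases)
    case equal
    then have "upair x y = pair x x"
      by (simp add: upair_def)
    with equal show ?thesis
      using E[of x x] by (auto simp: adj_def)
  next
    case less
    then show ?thesis by (simp add: adj_less upair_less)
  next
    case greater
    then show ?thesis
      by (simp add: adj_less upair_less upair_commute[of x] adj_commute[of E x])
  qed
  then show ?thesis
    using E unfolding nbhd_def adj_def by blast
qed

text \<open>The witness \<open>w\<close> bounds both neighbours: this is a bounded formula, and to
  branch, \<open>\<exists>w. branching E H x w\<close>, is \<Sigma>1.\<close>

definition branching :: "'a set \<Rightarrow> 'a set \<Rightarrow> 'a \<Rightarrow> 'a \<Rightarrow> bool" where
  "branching E H x w \<longleftrightarrow>
    x \<in> H \<and> (\<exists>y \<le> w. \<exists>z \<le> w. y \<in> H \<and> z \<in> H \<and> y \<noteq> z \<and> adj E x y \<and> adj E x z)"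

lemma D0_branching:
  assumes "E \<in> S" "H \<in> S"
  shows "D0 (\<lambda>e. branching E H (e 0) (e 1))"
  unfolding branching_def by (intro D0_intros D0_mem D0_adj assms)

lemma ex_branching_iff:
  "(\<exists>w. branching E H x w) \<longleftrightarrow>
    x \<in> H \<and> (\<exists>y \<in> H. \<exists>z \<in> H. y \<noteq> z \<and> adj E x y \<and> adj E x z)"
proof
  assume "x \<in> H \<and> (\<exists>y \<in> H. \<exists>z \<in> H. y \<noteq> z \<and> adj E x y \<and> adj E x z)"
  then obtain y z where "x \<in> H" "y \<in> H" "z \<in> H" "y \<noteq> z" "adj E x y" "adj E x z"
    by blast
  then have "branching E H x (max y z)"
    unfolding branching_def using max.cobounded1[of y z] max.cobounded2[of z y] by blast
  then show "\<exists>w. branching E H x w" ..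
qed (auto simp: branching_def)

text \<open>Dropping the greater end of each edge leaves an independent set. If it were bounded by
  \<open>b\<close>, every later vertex would be matched with one up to \<open>b\<close>, since a
  partner beyond \<open>b\<close> would have a second neighbour; but the partners of vertices up to
  \<open>b\<close> are bounded by \<open>strong_Sigma1_bounding\<close>.\<close>

lemma independent_subset_of_matching:
  assumes "E \<in> S" "H \<in> S" "unbounded H" and no: "\<And>x w. \<not> branching E H x w"
  obtains I where "I \<in> S" "I \<subseteq> H" "unbounded I" "\<And>x y. \<lbrakk>x \<in> I; y \<in> I\<rbrakk> \<Longrightarrow> \<not> adj E x y"
proof -
  have one: "y = z" if "x \<in> H" "y \<in> H" "z \<in> H" "adj E x y" "adj E x z" for x y z
    using no that ex_branching_iff by blast
  define I where "I = {x. x \<in> H \<and> (\<forall>y < x. y \<in> H \<longrightarrow> \<not> adj E x y)}"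
  have "I \<in> S"
    unfolding I_def by (intro D0_comprehension D0_intros D0_mem D0_adj assms)
  moreover have "unbounded I"
    unfolding unbounded_def
  proof (rule allI, rule ccontr)
    fix b
    assume bd: "\<not> (\<exists>x \<in> I. b < x)"
    have "D0 (\<lambda>e. e 1 \<in> H \<and> b < e 1 \<and> adj E (e 0) (e 1))"
      by (intro D0_intros D0_mem D0_adj assms)
    then obtain z where z: "\<And>x y. \<lbrakk>x < b + 1; y \<in> H \<and> b < y \<and> adj E x y\<rbrakk> \<Longrightarrow>
        \<exists>y \<le> z. y \<in> H \<and> b < y \<and> adj E x y"
      by (rule strong_Sigma1_bounding[where n = "b + 1"]) blast
    obtain y where y: "y \<in> H" "max b z < y"
      using assms(3) unfolding unbounded_def by blast
    then obtain x where x: "x < y" "x \<in> H" "adj E y x"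
      using bd unfolding I_def by auto
    have "x \<le> b"
    proof (rule ccontr)
      assume "\<not> x \<le> b"
      then obtain w where "w < x" "w \<in> H" "adj E x w"
        using bd x unfolding I_def by auto
      then show False
        using one[of x w y] x y by (auto simp: adj_commute)
    qed
    then obtain y' where "y' \<le> z" "y' \<in> H" "adj E x y'"
      using z[of x y] x y by (auto simp: less_add_one_iff adj_commute)
    then show False
      using one[of x y y'] x y by (auto simp: adj_commute)
  qed
  moreover have "\<not> adj E x y" if "x \<in> I" "y \<in> I" for x y
    using that adj_imp_neq[of E x y] adj_commute[of E x y] unfolding I_def by (cases x y rule: linorder_cases) auto
  ultimately show thesis
    using that unfolding I_def by blast
qed

lemma wRSg_dichotomy:
  assumes "wRSg S" and VE: "V \<in> S" "E \<in> S" "graph V E" "unbounded V"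
  obtains (independent) I where "I \<in> S" "I \<subseteq> V" "unbounded I"
      "\<And>x y. \<lbrakk>x \<in> I; y \<in> I\<rbrakk> \<Longrightarrow> \<not> adj E x y"
    | (branching) H r where "H \<in> S" "H \<subseteq> V" "\<exists>w. branching E H r w"
      "\<And>x w. branching E H x w \<Longrightarrow> unbounded {y. (\<exists>w. branching E H y w) \<and> adj E x y}"
proof -
  obtain H where H: "H \<in> S" "H \<subseteq> V" "unbounded H"
    and sol: "\<And>x. x \<in> H \<Longrightarrow> unbounded (H \<inter> {y. adj E x y}) \<or>
      (\<forall>y \<in> H \<inter> {y. adj E x y}. \<forall>z \<in> H \<inter> {y. adj E x y}. y = z)"
    using assms unfolding wRSg_def by (metis nbhd_eq_adj[OF VE(3)])
  consider "\<And>x w. \<not> branching E H x w"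
    | x where "\<exists>w. branching E H x w" "\<not> unbounded {y. (\<exists>w. branching E H y w) \<and> adj E x y}"
    | r where "\<exists>w. branching E H r w"
      "\<And>x w. branching E H x w \<Longrightarrow> unbounded {y. (\<exists>w. branching E H y w) \<and> adj E x y}"
    by blast
  then show thesis
  proof cases
    case 1
    with VE H obtain I where "I \<in> S" "I \<subseteq> H" "unbounded I" "\<And>x y. \<lbrakk>x \<in> I; y \<in> I\<rbrakk> \<Longrightarrow> \<not> adj E x y"
      using independent_subset_of_matching by metis
    then show thesis
      using independent H(2) by blast
  next
    case (2 x)
    obtain b where b: "\<And>y w. \<lbrakk>branching E H y w; adj E x y\<rbrakk> \<Longrightarrow> \<not> b < y"
      using 2(2) unfolding unbounded_def by auto
    \<comment> \<open>Beyond \<open>b\<close> no neighbour of \<open>x\<close> branches. Two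
      adjacent members of \<open>I\<close> would have each other and \<open>x\<close> as neighbours,
      hence branch.\<close>
    define I where "I = {y. y \<in> H \<and> b < y \<and> adj E x y}"
    \<comment> \<open>A branching vertex has two neighbours in \<open>H\<close>, which leaves only
      the unbounded alternative of \<open>sol\<close>.\<close>
    have x: "x \<in> H" "unbounded (H \<inter> {y. adj E x y})"
      using 2(1) sol unfolding ex_branching_iff by blast+
    have "I \<in> S"
      unfolding I_def by (intro D0_comprehension D0_intros D0_mem D0_adj VE H)
    moreover have "I \<subseteq> V"
      using H(2) by (auto simp: I_def)
    moreover have "unbounded I"
      unfolding unbounded_def
    proof
      fix a
      obtain y where "y \<in> H" "adj E x y" "max a b < y"
        using x(2) unfolding unbounded_def by blast
      then show "\<exists>y \<in> I. a < y"
        by (auto simp: I_def)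
    qed
    moreover have "\<not> adj E y z" if "y \<in> I" "z \<in> I" for y z
    proof
      assume "adj E y z"
      moreover have "adj E y x" "x \<noteq> z"
        using that adj_imp_neq[of E x z] adj_commute[of E x y] by (auto simp: I_def)
      ultimately have "\<exists>w. branching E H y w"
        using that x(1) unfolding ex_branching_iff I_def by blast
      then show False
        using b that by (auto simp: I_def)
    qed
    ultimately show thesis by (rule independent)
  next
    case (3 r)
    then show thesis using branching H by blast
  qed
qed

section \<open>Graphs cut out by a definable relation\<close>

definition edges :: "'a set \<Rightarrow> ('a \<Rightarrow> 'a \<Rightarrow> bool) \<Rightarrow> 'a set" where
  "edges V P = {p. \<exists>x \<le> p. \<exists>y \<le> p. p = pair x y \<and> x \<in> V \<and> y \<in> V \<and> x < y \<and> P x y}"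

lemma pair_in_edges: "pair x y \<in> edges V P \<longleftrightarrow> x \<in> V \<and> y \<in> V \<and> x < y \<and> P x y"
  unfolding edges_def using le_pair(1)[of x y] le_pair(2)[of y x] by (auto simp: pair_eq_iff)

lemma graph_edges: "graph V (edges V P)"
  unfolding graph_def two_subsets_eq edges_def by blast

lemma edges_mem:
  assumes "V \<in> S" "D0 (\<lambda>e. P (e 0) (e 1))"
  shows "edges V P \<in> S"
  unfolding edges_def
  by (intro D0_comprehension D0_intros D0_mem definable_term_pair D0_subst2[OF assms(2)] assms(1))

section \<open>The lexicographic order\<close>

text \<open>Lexicographic order of the characteristic strings of length \<open>n\<close>: at a first
  difference \<open>X\<close> has 0 and \<open>Y\<close> has 1.\<close>

definition lexle :: "'a \<Rightarrow> 'a set \<Rightarrow> 'a set \<Rightarrow> bool" where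
  "lexle n X Y \<longleftrightarrow> (\<forall>j < n. (\<forall>i < j. i \<in> X \<longleftrightarrow> i \<in> Y) \<longrightarrow> j \<in> X \<longrightarrow> j \<in> Y)"

lemma lexle_mono: "lexle n X Y \<Longrightarrow> k \<le> n \<Longrightarrow> lexle k X Y"
  unfolding lexle_def by (intro allI impI) (blast dest: less_le_trans)

lemma lexle_cong:
  assumes "\<And>i. i < n \<Longrightarrow> i \<in> X \<longleftrightarrow> i \<in> X'" "\<And>i. i < n \<Longrightarrow> i \<in> Y \<longleftrightarrow> i \<in> Y'"
  shows "lexle n X Y \<longleftrightarrow> lexle n X' Y'"
proof -
  have "i \<in> X \<longleftrightarrow> i \<in> X'" "i \<in> Y \<longleftrightarrow> i \<in> Y'" if "i < j" "j < n" for i j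
    using assms less_trans[OF that] by auto
  then show ?thesis
    unfolding lexle_def using assms by simp
qed

lemma lexle_linear:
  assumes "\<not> lexle n X Y"
  shows "lexle n Y X"
proof -
  obtain j where j: "j < n" "\<forall>i < j. i \<in> X \<longleftrightarrow> i \<in> Y" "j \<in> X" "j \<notin> Y"
    using assms unfolding lexle_def by blast
  show ?thesis
    unfolding lexle_def
  proof (intro allI impI)
    fix k
    assume "\<forall>i < k. i \<in> Y \<longleftrightarrow> i \<in> X" "k \<in> Y"
    then show "k \<in> X"
      using j(2-) by (cases k j rule: linorder_cases) auto
  qed
qed

text \<open>If \<open>X\<close> and \<open>Z\<close> agree below \<open>j\<close>, then
  \<open>Y\<close> between them agrees too. This is proved by induction along the order, which holds
  for sets of the model; hence the membership hypotheses.\<close>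

lemma lexle_trans:
  assumes "X \<in> S" "Y \<in> S" "Z \<in> S" and XY: "lexle n X Y" and YZ: "lexle n Y Z"
  shows "lexle n X Z"
  unfolding lexle_def
proof (intro allI impI)
  fix j
  assume "j < n" and XZ: "\<forall>i < j. i \<in> X \<longleftrightarrow> i \<in> Z" and "j \<in> X"
  have "{i. i < j \<longrightarrow> (i \<in> X \<longleftrightarrow> i \<in> Y)} \<in> S" (is "?D \<in> S")
    by (intro D0_comprehension D0_intros D0_mem assms)
  then have "i \<in> ?D" for i
  proof (rule less_induct_mem)
    fix i
    assume IH: "\<And>k. k < i \<Longrightarrow> k \<in> ?D"
    show "i \<in> ?D"
    proof (clarify)
      assume "i < j"
      then have "\<forall>k < i. k \<in> X \<longleftrightarrow> k \<in> Y" "\<forall>k < i. k \<in> Y \<longleftrightarrow> k \<in> Z" "i < n"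
        using IH XZ \<open>j < n\<close> by (auto dest: less_trans)
      then show "i \<in> X \<longleftrightarrow> i \<in> Y"
        using XY YZ XZ \<open>i < j\<close> unfolding lexle_def by blast
    qed
  qed
  then show "j \<in> Z"
    using XY YZ XZ \<open>j < n\<close> \<open>j \<in> X\<close> unfolding lexle_def by blast
qed

lemma lexle_antisym:
  assumes "X \<in> S" "Y \<in> S" and XY: "lexle n X Y" and YX: "lexle n Y X" and "j < n"
  shows "j \<in> X \<longleftrightarrow> j \<in> Y"
proof -
  have "{i. i < n \<longrightarrow> (i \<in> X \<longleftrightarrow> i \<in> Y)} \<in> S" (is "?D \<in> S")
    by (intro D0_comprehension D0_intros D0_mem assms)
  then have "j \<in> ?D"
  proof (rule less_induct_mem)
    fix i
    assume IH: "\<And>k. k < i \<Longrightarrow> k \<in> ?D"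
    show "i \<in> ?D"
    proof (clarify)
      assume "i < n"
      then have "\<forall>k < i. k \<in> X \<longleftrightarrow> k \<in> Y"
        using IH by (auto dest: less_trans)
      then show "i \<in> X \<longleftrightarrow> i \<in> Y"
        using XY YX \<open>i < n\<close> unfolding lexle_def by blast
    qed
  qed
  then show ?thesis using \<open>j < n\<close> by blast
qed

text \<open>
  Past a stage by which every string of length \<open>n\<close> that ever occurs has occurred, monotonicity rules
  out any change.
\<close>

lemma lex_monotone_stabilizes:
  assumes R: "D0 (\<lambda>e. R (e 0) (e 1))" and "I \<in> S"
    and mono: "(\<forall>x \<in> I. \<forall>y \<in> I. x < y \<longrightarrow> lexle x {i. R i x} {i. R i y}) \<or>
      (\<forall>x \<in> I. \<forall>y \<in> I. x < y \<longrightarrow> lexle x {i. R i y} {i. R i x})"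
  obtains z where "\<And>j x y. \<lbrakk>j < n; x \<in> I; y \<in> I; z < x; z < y\<rbrakk> \<Longrightarrow> R j x \<longleftrightarrow> R j y"
proof -
  define \<sigma> where "\<sigma> = (\<lambda>x. {i. R i x})"
  have \<sigma>: "\<sigma> x \<in> S" for x
    unfolding \<sigma>_def by (intro D0_comprehension D0_subst2[OF R] D0_intros)
  obtain m B where code: "\<And>X. X \<in> S \<Longrightarrow> \<exists>a \<le> B. \<forall>x < n. x \<in> codeset m a \<longleftrightarrow> x \<in> X"
    using uniform_codes[of n] by metis
  \<comment> \<open>\<open>a\<close> codes the string of length \<open>n\<close> at
    \<open>y\<close>. Bounding over all codes \<open>a \<le> B\<close> gives the stage by which
    every string that occurs beyond \<open>n\<close> has occurred.\<close>
  define Q where "Q = (\<lambda>a y. y \<in> I \<and> n < y \<and> (\<forall>j < n. j \<in> codeset m a \<longleftrightarrow> R j y))"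
  have "D0 (\<lambda>e. Q (e 0) (e 1))"
    unfolding Q_def by (intro D0_intros D0_mem D0_codeset D0_subst2[OF R] assms(2))
  then obtain z where z: "\<And>a y. \<lbrakk>a < B + 1; Q a y\<rbrakk> \<Longrightarrow> \<exists>y \<le> z. Q a y"
    using strong_Sigma1_bounding[of Q "B + 1"] by metis
  have old: "\<exists>u \<in> I. n < u \<and> u \<le> z \<and> (\<forall>j < n. j \<in> \<sigma> u \<longleftrightarrow> j \<in> \<sigma> y)" if "y \<in> I" "n < y" for y
  proof -
    obtain a where a: "a \<le> B" "\<forall>x < n. x \<in> codeset m a \<longleftrightarrow> x \<in> \<sigma> y"
      using code[OF \<sigma>] by blast
    then have "Q a y"
      using that by (simp add: Q_def \<sigma>_def)
    then obtain u where "u \<le> z" "Q a u"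
      using z a(1) by (metis less_add_one_iff)
    then show ?thesis
      using a(2) unfolding Q_def \<sigma>_def by blast
  qed
  have stable: "j \<in> \<sigma> x \<longleftrightarrow> j \<in> \<sigma> y"
    if "j < n" "x \<in> I" "y \<in> I" "max n z < x" "x < y" for j x y
  proof -
    have "n < y"
      using that by (auto dest: less_trans)
    then obtain u where u: "u \<in> I" "n < u" "u \<le> z" "\<And>j. j < n \<Longrightarrow> j \<in> \<sigma> u \<longleftrightarrow> j \<in> \<sigma> y"
      using old[OF \<open>y \<in> I\<close>] by blast
    have ux: "u < x" "n \<le> x" "n \<le> u"
      using u that by (auto dest: le_less_trans)
    \<comment> \<open>The order is \<open>u < x < y\<close>, and \<open>u\<close> and
      \<open>y\<close> carry the same string of length \<open>n\<close>, so that of \<open>x\<close>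
      is squeezed between equal ones. Monotonicity compares only up to the smaller index, which must
      therefore be at least \<open>n\<close>.\<close>
    consider (1) "lexle n (\<sigma> u) (\<sigma> x)" "lexle n (\<sigma> x) (\<sigma> y)"
      | (2) "lexle n (\<sigma> x) (\<sigma> u)" "lexle n (\<sigma> y) (\<sigma> x)"
      using mono
    proof
      assume "\<forall>x \<in> I. \<forall>y \<in> I. x < y \<longrightarrow> lexle x {i. R i x} {i. R i y}"
      then have "lexle u (\<sigma> u) (\<sigma> x)" "lexle x (\<sigma> x) (\<sigma> y)"
        using u(1) ux(1) \<open>x \<in> I\<close> \<open>y \<in> I\<close> \<open>x < y\<close> unfolding \<sigma>_def by blast+
      then show thesis
        using 1 lexle_mono ux(2,3) by blast
    next
      assume "\<forall>x \<in> I. \<forall>y \<in> I. x < y \<longrightarrow> lexle x {i. R i y} {i. R i x}"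
      then have "lexle u (\<sigma> x) (\<sigma> u)" "lexle x (\<sigma> y) (\<sigma> x)"
        using u(1) ux(1) \<open>x \<in> I\<close> \<open>y \<in> I\<close> \<open>x < y\<close> unfolding \<sigma>_def by blast+
      then show thesis
        using 2 lexle_mono ux(2,3) by blast
    qed
    then show ?thesis
    proof cases
      case 1
      then have "lexle n (\<sigma> y) (\<sigma> x)"
        using u(4) lexle_cong[of n "\<sigma> u" "\<sigma> y" "\<sigma> x" "\<sigma> x"] by simp
      with 1 show ?thesis
        using lexle_antisym[OF \<sigma> \<sigma>] \<open>j < n\<close> by blast
    next
      case 2
      then have "lexle n (\<sigma> x) (\<sigma> y)"
        using u(4) lexle_cong[of n "\<sigma> x" "\<sigma> x" "\<sigma> u" "\<sigma> y"] by simp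
      with 2 show ?thesis
        using lexle_antisym[OF \<sigma> \<sigma>] \<open>j < n\<close> by blast
    qed
  qed
  show thesis
  proof (rule that)
    fix j x y
    assume "j < n" "x \<in> I" "y \<in> I" "max n z < x" "max n z < y"
    then show "R j x \<longleftrightarrow> R j y"
      using stable[of j x y] stable[of j y x] unfolding \<sigma>_def
      by (cases x y rule: linorder_cases) auto
  qed
qed

section \<open>The equivalences\<close>

text \<open>On an independent set the strings descend weakly, by linearity. Otherwise a sequence of
  branching vertices is extended by a late branching neighbour of its greatest member; transitivity
  relates the earlier members to it.\<close>

lemma wRSg_imp_lex_monotone:
  assumes "wRSg S" and R: "D0 (\<lambda>e. R (e 0) (e 1))"
  obtains I where "I \<in> S" "unbounded I"
    "(\<forall>x \<in> I. \<forall>y \<in> I. x < y \<longrightarrow> lexle x {i. R i x} {i. R i y}) \<or>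
      (\<forall>x \<in> I. \<forall>y \<in> I. x < y \<longrightarrow> lexle x {i. R i y} {i. R i x})"
proof -
  define \<sigma> where "\<sigma> = (\<lambda>x. {i. R i x})"
  have \<sigma>: "\<sigma> x \<in> S" for x
    unfolding \<sigma>_def by (intro D0_comprehension D0_subst2[OF R] D0_intros)
  define L where "L = (\<lambda>x y. lexle x (\<sigma> x) (\<sigma> y))"
  have L: "D0 (\<lambda>e. L (e 0) (e 1))"
    unfolding L_def lexle_def \<sigma>_def mem_Collect_eq by (intro D0_intros D0_subst2[OF R])
  have trans: "L x z" if "L x y" "L y z" "x < y" for x y z
    using that lexle_trans[OF \<sigma> \<sigma> \<sigma>] lexle_mono[of y "\<sigma> y" "\<sigma> z" x] unfolding L_def by auto
  have unb: "unbounded (UNIV :: 'a set)"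
    unfolding unbounded_def by (metis UNIV_I less_add_one_iff order_refl)
  define E where "E = edges UNIV L"
  have E: "E \<in> S" "graph UNIV E"
    unfolding E_def using edges_mem[OF UNIV_mem L] graph_edges by auto
  have adj: "adj E x y \<longleftrightarrow> L x y" if "x < y" for x y
    using that by (simp add: E_def adj_less pair_in_edges)
  from assms(1) UNIV_mem E unb show thesis
  proof (cases rule: wRSg_dichotomy)
    case (independent I)
    then have "lexle x (\<sigma> y) (\<sigma> x)" if "x \<in> I" "y \<in> I" "x < y" for x y
      using that adj lexle_linear unfolding L_def by blast
    then show thesis
      using that[of I] independent(1,3) unfolding \<sigma>_def by blast
  next
    case (branching H r)
    have extend: "\<exists>x w. n < x \<and> branching E H x w \<and> (\<forall>y \<in> F. L y x)"
      if F: "F \<in> S" "\<And>x. x \<in> F \<Longrightarrow> x \<le> n \<and> (\<exists>w. branching E H x w)"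
        "\<And>x y. \<lbrakk>x \<in> F; y \<in> F; x < y\<rbrakk> \<Longrightarrow> L x y" for n F
    proof (cases "F = {}")
      case True
      then show ?thesis
        using branching(3,4) unfolding unbounded_def by blast
    next
      case False
      then obtain a where "a \<in> F" by blast
      then obtain m where m: "m \<in> F" "\<And>b. b \<in> F \<Longrightarrow> b \<le> m"
        using ex_max[OF F(1)] F(2) by metis
      obtain x where x: "n < x" "\<exists>w. branching E H x w" "adj E m x"
        using F(2)[OF m(1)] branching(4)[of m] unfolding unbounded_def by blast
      have "m < x"
        using F(2)[OF m(1)] x(1) by (auto dest: le_less_trans)
      then have "L m x"
        using x(3) adj by blast
      then have "L y x" if "y \<in> F" for y
        using trans[of y m x] F(3)[of y m] m that by (cases "y = m") (auto simp: le_less)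
      then show ?thesis
        using x by blast
    qed
    obtain I where "I \<in> S" "unbounded I" "\<And>x y. \<lbrakk>x \<in> I; y \<in> I; x < y\<rbrakk> \<Longrightarrow> L x y"
    proof (rule greedy_sequence[OF D0_branching[OF E(1) branching(1)] L])
      show "\<exists>x w. n < x \<and> branching E H x w \<and> (\<forall>y \<in> F. L y x)"
        if "F \<in> S" "\<And>x. x \<in> F \<Longrightarrow> x \<le> n \<and> (\<exists>w. branching E H x w)"
          "\<And>x y. \<lbrakk>x \<in> F; y \<in> F; x < y\<rbrakk> \<Longrightarrow> L x y" for n F
        using that by (rule extend)
    qed (rule that)
    then show thesis
      using that[of I] unfolding L_def \<sigma>_def by blast
  qed
qed

lemma wRSg_imp_homogeneous:
  assumes "wRSg S" and R: "D0 (\<lambda>e. R (e 0) (e 1))"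
  obtains H where "H \<in> S" "unbounded H"
    "(\<forall>x \<in> H. \<forall>y \<in> H. x < y \<longrightarrow> R x y) \<or> (\<forall>x \<in> H. \<forall>y \<in> H. x < y \<longrightarrow> \<not> R x y)"
proof -
  obtain I where I: "I \<in> S" "unbounded I" and mono:
    "(\<forall>x \<in> I. \<forall>y \<in> I. x < y \<longrightarrow> lexle x {i. R i x} {i. R i y}) \<or>
      (\<forall>x \<in> I. \<forall>y \<in> I. x < y \<longrightarrow> lexle x {i. R i y} {i. R i x})"
    using wRSg_imp_lex_monotone[OF assms] by blast
  define E where "E = edges I R"
  have E: "E \<in> S" "graph I E"
    unfolding E_def using edges_mem[OF I(1) R] graph_edges by auto
  have adj: "adj E x y \<longleftrightarrow> x \<in> I \<and> y \<in> I \<and> R x y" if "x < y" for x y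
    using that by (auto simp: E_def adj_less pair_in_edges)
  from assms(1) I(1) E I(2) show thesis
  proof (cases rule: wRSg_dichotomy)
    case (independent J)
    then have "\<not> R x y" if "x \<in> J" "y \<in> J" "x < y" for x y
      using that adj by blast
    then show thesis
      using that[of J] independent(1,3) by blast
  next
    case (branching H r)
    have "\<exists>x w. n < x \<and> branching E H x w \<and> (\<forall>y \<in> F. R y x)"
      if F: "\<And>x. x \<in> F \<Longrightarrow> x \<le> n \<and> (\<exists>w. branching E H x w)" for n F
    proof -
      \<comment> \<open>One stage \<open>z\<close> serves all \<open>j \<le> n\<close>, hence all of
        \<open>F\<close> at once.\<close>
      obtain z where z: "\<And>j x y. \<lbrakk>j < n + 1; x \<in> I; y \<in> I; z < x; z < y\<rbrakk> \<Longrightarrow> R j x \<longleftrightarrow> R j y"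
        using lex_monotone_stabilizes[OF R I(1) mono, of "n + 1"] by metis
      obtain x where x: "max n z < x" "\<exists>w. branching E H x w"
        using branching(3,4) unfolding unbounded_def by blast
      then have "x \<in> I"
        using branching(2) unfolding ex_branching_iff by blast
      \<comment> \<open>A neighbour \<open>v\<close> of \<open>y\<close> beyond \<open>z\<close>
        shows that the eventual colour of \<open>y\<close> is \<open>R\<close>; since
        \<open>x\<close> is also beyond \<open>z\<close>, it receives the same colour.\<close>
      have "R y x" if "y \<in> F" for y
      proof -
        obtain v where v: "max n z < v" "\<exists>w. branching E H v w" "adj E y v"
          using F[OF \<open>y \<in> F\<close>] branching(4)[of y] unfolding unbounded_def by blast
        then have "y < v"
          using F[OF \<open>y \<in> F\<close>] by (auto dest: le_less_trans)
        then have "R y v" "v \<in> I"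
          using v(3) adj by auto
        then show ?thesis
          using z[of y v x] x(1) v(1) \<open>x \<in> I\<close> F[OF \<open>y \<in> F\<close>] by (auto simp: less_add_one_iff)
      qed
      then show ?thesis
        using x by auto
    qed
    then obtain J where "J \<in> S" "unbounded J" "\<And>x y. \<lbrakk>x \<in> J; y \<in> J; x < y\<rbrakk> \<Longrightarrow> R x y"
      using greedy_sequence[OF D0_branching[OF E(1) branching(1)] R] by metis
    then show thesis
      using that[of J] by blast
  qed
qed

section \<open>The implications between the three principles\<close>

lemma wRSg_imp_RT22:
  assumes "wRSg S"
  shows "RT22 S"
  unfolding RT22_def
proof (intro ballI impI)
  fix c
  assume "c \<in> S" and c: "coded_fun c (two_subsets UNIV) {0, 1}"
  have "D0 (\<lambda>e. pair (pair (e 0) (e 1)) 1 \<in> c)"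
    by (intro D0_mem definable_term_pair D0_intros \<open>c \<in> S\<close>)
  with assms obtain H where H: "H \<in> S" "unbounded H"
    "(\<forall>x \<in> H. \<forall>y \<in> H. x < y \<longrightarrow> pair (pair x y) 1 \<in> c) \<or>
      (\<forall>x \<in> H. \<forall>y \<in> H. x < y \<longrightarrow> pair (pair x y) 1 \<notin> c)"
    by (rule wRSg_imp_homogeneous)
  have "pair (pair x y) 0 \<in> c \<or> pair (pair x y) 1 \<in> c" if "x < y" for x y
    using c that unfolding coded_fun_def two_subsets_eq by blast
  then have "\<exists>i \<in> {0, 1}. \<forall>p \<in> two_subsets H. pair p i \<in> c"
    using H(3) unfolding two_subsets_eq by blast
  then show "\<exists>H \<in> S. unbounded H \<and> (\<exists>i \<in> {0, 1}. \<forall>p \<in> two_subsets H. pair p i \<in> c)"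
    using H by blast
qed

lemma wRSgr_imp_wRSg:
  assumes "wRSgr S"
  shows "wRSg S"
  unfolding wRSg_def
proof (intro ballI impI)
  fix V E
  assume "V \<in> S" "E \<in> S" "graph V E \<and> unbounded V"
  then obtain H where "H \<in> S" "H \<subseteq> V" "unbounded H"
    "\<forall>x \<in> H. unbounded (H \<inter> nbhd V E x) \<or> H \<inter> nbhd V E x = {}"
    using assms unfolding wRSgr_def by blast
  then show "\<exists>H \<in> S. H \<subseteq> V \<and> unbounded H \<and> (\<forall>x \<in> H. unbounded (H \<inter> nbhd V E x) \<or>
      (\<forall>y \<in> H \<inter> nbhd V E x. \<forall>z \<in> H \<inter> nbhd V E x. y = z))"
    by (intro bexI[of _ H]) auto
qed

text \<open>
  A colouring of all pairs is pulled back from \<open>V\<close> along the map sending \<open>x\<close> to the largest element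
  of \<open>V\<close> up to \<open>x\<close>; this avoids enumerating \<open>V\<close>.
\<close>

lemma RT22_imp_wRSgr:
  assumes "RT22 S"
  shows "wRSgr S"
  unfolding wRSgr_def
proof (intro ballI impI)
  fix V E
  assume VE: "V \<in> S" "E \<in> S" and "graph V E \<and> unbounded V"
  then have G: "graph V E" and V: "unbounded V" by auto
  define prev where "prev = (\<lambda>x v. v \<in> V \<and> v \<le> x \<and> (\<forall>u \<le> x. u \<in> V \<longrightarrow> u \<le> v))"
  have "D0 (\<lambda>e. prev (e 0) (e 1))"
    unfolding prev_def by (intro D0_intros D0_mem VE)
  note D0_prev = D0_subst2[where Q = prev, OF this]
  have prev_unique: "v = w" if "prev x v" "prev x w" for x v w
    using that by (auto simp: prev_def intro: order.antisym)
  have prev_ex: "\<exists>w \<ge> v. prev x w" if "v \<in> V" "v \<le> x" for x v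
  proof -
    have "{a. a \<in> V \<and> a \<le> x} \<in> S" (is "?X \<in> S")
      by (intro D0_comprehension D0_intros D0_mem VE)
    moreover have "v \<in> ?X"
      using that by simp
    ultimately obtain w where "w \<in> ?X" "\<And>b. b \<in> ?X \<Longrightarrow> b \<le> w"
      using ex_max[of ?X v x] by blast
    then show ?thesis
      using that unfolding prev_def by blast
  qed
  \<comment> \<open>Where \<open>x\<close> lies below all of \<open>V\<close>, no \<open>v\<close>
    exists and \<open>R x y\<close> is false by default.\<close>
  define R where "R = (\<lambda>x y. \<exists>v \<le> y. \<exists>w \<le> y. prev x v \<and> prev y w \<and> pair v w \<in> E)"
  have R_iff: "R x y \<longleftrightarrow> pair v w \<in> E" if "prev x v" "prev y w" "x < y" for x y v w
  proof -
    have "v \<le> y" "w \<le> y"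
      using that by (auto simp: prev_def)
    then show ?thesis
      unfolding R_def using prev_unique that by blast
  qed
  define D where "D = edges UNIV R"
  have "D0 (\<lambda>e. R (e 0) (e 1))"
    unfolding R_def by (intro D0_intros D0_mem definable_term_pair D0_prev VE)
  then have D: "D \<in> S"
    unfolding D_def by (rule edges_mem[OF UNIV_mem])
  define T where "T = edges UNIV (\<lambda>x y. x = x)"
  have T: "T \<in> S"
    unfolding T_def by (intro edges_mem UNIV_mem D0_intros)
  have T_eq: "T = two_subsets UNIV"
    unfolding T_def edges_def two_subsets_eq using le_pair by blast
  define c where "c = {u. \<exists>p \<le> u. \<exists>i \<le> u. u = pair p i \<and> p \<in> T \<and> (i = 1 \<and> p \<in> D \<or> i = 0 \<and> p \<notin> D)}"
  have c_iff: "pair p i \<in> c \<longleftrightarrow> p \<in> T \<and> (i = 1 \<and> p \<in> D \<or> i = 0 \<and> p \<notin> D)" for p i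
    unfolding c_def using le_pair(1)[of p i] le_pair(2)[of i p] by (auto simp: pair_eq_iff)
  have "c \<in> S"
    unfolding c_def by (intro D0_comprehension D0_intros D0_mem definable_term_pair T D)
  moreover have "coded_fun c (two_subsets UNIV) {0, 1}"
    unfolding coded_fun_def T_eq[symmetric]
  proof
    show "c \<subseteq> {pair x y |x y. x \<in> T \<and> y \<in> {0, 1}}"
      unfolding c_def by blast
    show "\<forall>x \<in> T. \<exists>!y. y \<in> {0, 1} \<and> pair x y \<in> c"
      unfolding c_iff by auto
  qed
  ultimately obtain H i where H: "H \<in> S" "unbounded H" "\<And>p. p \<in> two_subsets H \<Longrightarrow> pair p i \<in> c"
    using assms unfolding RT22_def by blast
  have hom: "R x y \<longleftrightarrow> i = 1" if "x \<in> H" "y \<in> H" "x < y" for x y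
  proof -
    have "pair (pair x y) i \<in> c"
      using H(3) that unfolding two_subsets_eq by blast
    then show ?thesis
      using that(3) unfolding c_iff D_def pair_in_edges by auto
  qed
  define W where "W = {v. \<exists>x. x \<in> H \<and> prev x v}"
  have "W \<in> S"
    unfolding W_def
  proof (rule Delta1_comprehension)
    show "D0 (\<lambda>e. e 1 \<in> H \<and> prev (e 1) (e 0))"
      by (intro D0_intros D0_mem D0_prev H)
    \<comment> \<open>For \<open>u\<close> in \<open>V\<close> with \<open>v < u\<close>, every
      \<open>x \<ge> u\<close> is sent to an element that is at least \<open>u\<close>, so searching
      the \<open>x < u\<close> decides whether \<open>v\<close> is an image.\<close>
    show "D0 (\<lambda>e. e 0 \<notin> V \<or> e 1 \<in> V \<and> e 0 < e 1 \<and> (\<forall>x < e 1. x \<in> H \<longrightarrow> \<not> prev x (e 0)))"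
      by (intro D0_intros D0_mem D0_prev H VE)
    show "(\<exists>x. x \<in> H \<and> prev x v) \<longleftrightarrow>
      \<not> (\<exists>u. v \<notin> V \<or> u \<in> V \<and> v < u \<and> (\<forall>x < u. x \<in> H \<longrightarrow> \<not> prev x v))" for v
    proof
      assume "\<exists>x. x \<in> H \<and> prev x v"
      then show "\<not> (\<exists>u. v \<notin> V \<or> u \<in> V \<and> v < u \<and> (\<forall>x < u. x \<in> H \<longrightarrow> \<not> prev x v))"
        unfolding prev_def by (meson not_le)
    next
      assume no: "\<not> (\<exists>u. v \<notin> V \<or> u \<in> V \<and> v < u \<and> (\<forall>x < u. x \<in> H \<longrightarrow> \<not> prev x v))"
      obtain u where "u \<in> V" "v < u"
        using V unfolding unbounded_def by blast
      then show "\<exists>x. x \<in> H \<and> prev x v"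
        using no by blast
    qed
  qed
  have "W \<subseteq> V"
    unfolding W_def prev_def by blast
  have W: "unbounded W"
    unfolding unbounded_def
  proof
    fix a
    obtain v where v: "v \<in> V" "a < v" using V unfolding unbounded_def by blast
    obtain x where x: "x \<in> H" "v < x" using H(2) unfolding unbounded_def by blast
    obtain w where "v \<le> w" "prev x w"
      using prev_ex[OF v(1) less_imp_le[OF x(2)]] by blast
    then show "\<exists>w \<in> W. a < w"
      using x(1) v(2) unfolding W_def by (auto intro: less_le_trans)
  qed
  have adj: "adj E v w \<longleftrightarrow> i = 1" if "v \<in> W" "w \<in> W" "v < w" for v w
  proof -
    obtain x y where xy: "x \<in> H" "prev x v" "y \<in> H" "prev y w"
      using \<open>v \<in> W\<close> \<open>w \<in> W\<close> unfolding W_def by blast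
    \<comment> \<open>The map given by \<open>prev\<close> is monotone, so the order of the images
      determines that of the arguments.\<close>
    have "x < y"
    proof (rule ccontr)
      assume "\<not> x < y"
      then have "w \<le> x" "w \<in> V"
        using xy(4) unfolding prev_def by auto
      then show False
        using xy(2) \<open>v < w\<close> unfolding prev_def by auto
    qed
    then show ?thesis
      using R_iff[OF xy(2,4)] hom[OF xy(1,3)] adj_less[OF \<open>v < w\<close>] by blast
  qed
  have "unbounded (W \<inter> nbhd V E v) \<or> W \<inter> nbhd V E v = {}" if "v \<in> W" for v
  proof (cases "i = 1")
    case True
    have "\<exists>w \<in> W \<inter> nbhd V E v. a < w" for a
    proof -
      obtain w where "w \<in> W" "max a v < w"
        using W unfolding unbounded_def by blast
      then show ?thesis
        using adj[OF \<open>v \<in> W\<close>] True by (auto simp: nbhd_eq_adj[OF G])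
    qed
    then show ?thesis by (auto simp: unbounded_def)
  next
    case False
    then have "\<not> adj E v w" if "w \<in> W" for w
      using adj[OF \<open>v \<in> W\<close> that] adj[OF that \<open>v \<in> W\<close>] adj_imp_neq[of E v w] adj_commute[of E v w]
      by (cases v w rule: linorder_cases) auto
    then show ?thesis by (auto simp: nbhd_eq_adj[OF G])
  qed
  then show "\<exists>H \<in> S. H \<subseteq> V \<and> unbounded H \<and>
      (\<forall>x \<in> H. unbounded (H \<inter> nbhd V E x) \<or> H \<inter> nbhd V E x = {})"
    by (intro bexI[of _ W] conjI ballI \<open>W \<in> S\<close> \<open>W \<subseteq> V\<close> W)
qed

end

theorem theorem3p6:
  fixes S :: "'a::{discrete_linordered_semidom, canonically_ordered_monoid_add} set set"
  assumes "models_RCA0 S"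
  shows "(RT22 S \<longleftrightarrow> wRSg S) \<and> (wRSg S \<longleftrightarrow> wRSgr S)"
proof -
  interpret rca0 S
    using assms by (rule rca0.intro)
  show ?thesis
    using RT22_imp_wRSgr wRSgr_imp_wRSg wRSg_imp_RT22 by blast
qed

end
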